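(* Let $n\ge2$. The free generators of the algebra $T(V^{(n)}\oplus V^{(n-1,1)})^{\mathfrak S_n}$ are counted by the words which reduce to the identity without crossing the identity in $\Gamma(\mathfrak S_n,\{e,(1\,2),(1\,3\,2),\dots,(1\,n\,\cdots\,4\,3\,2)\})$; that is, for every $d\ge1$, the number of generators of degree $d$ in a homogeneous free generating set of $T(V^{(n)}\oplus V^{(n-1,1)})^{\mathfrak S_n}$ equals the number of words of length $d$ in this Cayley graph which reduce to the identity without crossing the identity.
   Context: $\mathfrak S_n$ is the symmetric group on $\{1,\dots,n\}$ with identity $e$. $V^{(n)}\oplus V^{(n-1,1)}$ (trivial plus geometric module) is the permutation module over $\mathbb Q$, with basis $x_1,\dots,x_n$ permuted by $\mathfrak S_n$. $T(V)=\bigoplus_{d\ge0}V^{\otimes d}$ is the tensor algebra with diagonal group action and $T(V)^{G}$ its graded subalgebra of $G$-invariants. It is a known fact that, for a finite group $G$, $T(V)^G$ is a free associative algebra on a set of homogeneous generators (so the number of generators in each degree is well defined). The set of generators of the Cayley graph is $S=\{e,c_2,\dots,c_n\}$ with $c_k=(1\;k\;k-1\;\cdots\;2)$ in cycle notation. In the Cayley graph $\Gamma(G,S)$ there is a directed edge $g\to gs$ for each $g\in G$, $s\in S$. A word of length $d$ reduces to $g$ if it is a sequence $(s_1,\dots,s_d)\in S^d$ with $s_1\cdots s_d=g$ (the letter $e$ is a genuine letter, counted in the length). It does not cross the identity if no nonempty proper prefix reduces to the identity, i.e. $s_1\cdots s_j\ne e$ in $\mathfrak S_n$ for $1\le j<d$.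 *)

theory Defs
  imports Complex_Main "HOL-Library.Poly_Mapping" "HOL-Combinatorics.Cycles"
begin

text \<open>The free monoid on a type, written additively so that the finitely supported functions of
  \<^theory>\<open>HOL-Library.Poly_Mapping\<close> form its monoid algebra (a noncommutative ring).\<close>

datatype 'a ncmon = NCMon (letters: "'a list")

instantiation ncmon :: (type) monoid_add
begin

definition zero_ncmon :: "'a ncmon" where
  "0 = NCMon []"

definition plus_ncmon :: "'a ncmon \<Rightarrow> 'a ncmon \<Rightarrow> 'a ncmon" where
  "u + v = NCMon (letters u @ letters v)"

instance
  by standard (simp_all add: zero_ncmon_def plus_ncmon_def)

end

type_synonym 'a ncpoly = "'a ncmon \<Rightarrow>\<^sub>0 rat"

definition free_algebra :: "'a set \<Rightarrow> 'a ncpoly set" where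
  "free_algebra X = {p. \<forall>w\<in>Poly_Mapping.keys p. set (letters w) \<subseteq> X}"

definition homogeneous :: "nat \<Rightarrow> 'a ncpoly \<Rightarrow> bool" where
  "homogeneous d p \<longleftrightarrow> (\<forall>w\<in>Poly_Mapping.keys p. length (letters w) = d)"

text \<open>The permutation module \<open>V\<close> has basis \<open>x\<^sub>1, \<dots>, x\<^sub>n\<close>, so the tensors
  \<open>x\<^bsub>i\<^sub>1\<^esub> \<otimes> \<dots> \<otimes> x\<^bsub>i\<^sub>d\<^esub>\<close> form a basis of the \<open>d\<close>-fold tensor power of \<open>V\<close>; such a tensor is the
  word \<open>[i\<^sub>1, \<dots>, i\<^sub>d]\<close>, and the product of the tensor algebra is concatenation.\<close>

definition tensor_algebra :: "nat \<Rightarrow> nat ncpoly set" where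
  "tensor_algebra n = free_algebra {1..n}"

definition diag_act :: "(nat \<Rightarrow> nat) \<Rightarrow> nat ncpoly \<Rightarrow> nat ncpoly" where
  "diag_act \<sigma> p = (\<Sum>w\<in>Poly_Mapping.keys p.
     Poly_Mapping.single (NCMon (map \<sigma> (letters w))) (Poly_Mapping.lookup p w))"

definition invariant_algebra :: "nat \<Rightarrow> nat ncpoly set" where
  "invariant_algebra n =
     {p \<in> tensor_algebra n. \<forall>\<sigma>. \<sigma> permutes {1..n} \<longrightarrow> diag_act \<sigma> p = p}"

text \<open>The algebra homomorphism from the free algebra with letters in an algebra that sends every
  letter to itself; \<open>Poly_Mapping.single 0 c\<close> is the scalar \<open>c\<close>.\<close>

definition eval_nc :: "'a ncpoly ncpoly \<Rightarrow> 'a ncpoly" where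
  "eval_nc P = (\<Sum>W\<in>Poly_Mapping.keys P.
     Poly_Mapping.single 0 (Poly_Mapping.lookup P W) * prod_list (letters W))"

definition free_generating_set :: "'a ncpoly set \<Rightarrow> 'a ncpoly set \<Rightarrow> bool" where
  "free_generating_set A B \<longleftrightarrow> bij_betw eval_nc (free_algebra B) A"

definition homogeneous_free_generating_set :: "'a ncpoly set \<Rightarrow> 'a ncpoly set \<Rightarrow> bool" where
  "homogeneous_free_generating_set A B \<longleftrightarrow>
     free_generating_set A B \<and> (\<forall>b\<in>B. \<exists>d. homogeneous d b)"

text \<open>\<open>cayley_cycle k\<close> maps \<open>1\<close> to \<open>k\<close> and \<open>i\<close> to \<open>i - 1\<close> for \<open>2 \<le> i \<le> k\<close>.\<close>

definition cayley_cycle :: "nat \<Rightarrow> nat \<Rightarrow> nat" where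
  "cayley_cycle k = cycle_of_list (1 # rev [2..<Suc k])"

definition cayley_generators :: "nat \<Rightarrow> (nat \<Rightarrow> nat) set" where
  "cayley_generators n = insert id (cayley_cycle ` {2..n})"

text \<open>Permutations are multiplied as functions. Multiplying in the opposite order would reverse
  the words counted below and leave their number unchanged.\<close>

definition word_product :: "('a \<Rightarrow> 'a) list \<Rightarrow> 'a \<Rightarrow> 'a" where
  "word_product ws = foldr (\<circ>) ws id"

definition reduces_to :: "('a \<Rightarrow> 'a) list \<Rightarrow> ('a \<Rightarrow> 'a) \<Rightarrow> bool" where
  "reduces_to ws g \<longleftrightarrow> word_product ws = g"

definition crosses_identity :: "('a \<Rightarrow> 'a) list \<Rightarrow> bool" where
  "crosses_identity ws \<longleftrightarrow> (\<exists>j. 1 \<le> j \<and> j < length ws \<and> reduces_to (take j ws) id)"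

definition noncrossing_words :: "nat \<Rightarrow> nat \<Rightarrow> (nat \<Rightarrow> nat) list set" where
  "noncrossing_words n d =
     {ws \<in> lists (cayley_generators n).
        length ws = d \<and> reduces_to ws id \<and> \<not> crosses_identity ws}"

end

theory Submission
  imports Defs "HOL-Library.List_Lexorder"
begin

text \<open>
  The basis words \<open>x\<^sub>i\<^sub>1 \<dots> x\<^sub>i\<^sub>d\<close> of the tensor algebra are permuted by the symmetric group, so the
  invariants have a basis of orbit sums, one for each orbit of words. Represent an orbit by its
  lexicographically smallest word. These orbit-minimal words form a prefix-closed submonoid of the free
  monoid on \<open>1, \<dots>, n\<close>, and such a submonoid is itself free
  (\<open>bij_betw_concat_indecomposables\<close>). Its free generators are the indecomposable words: the nonempty
  orbit-minimal words without an orbit-minimal proper nonempty suffix.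

  The smallest word of a product of orbit sums is the concatenation of the smallest words of the
  factors. By triangularity, the products of the orbit sums of indecomposable words are linearly
  independent, and in each degree they are as many as the orbit sums themselves. So they form a basis,
  which means that the orbit sums of indecomposable words generate the invariants freely
  (\<open>orbit_sums_freely_generate\<close>).

  For any other homogeneous free generating set, the words of total degree \<open>d\<close> in the generators also
  form a basis of the invariants of degree \<open>d\<close>. The number of such words for all \<open>d\<close> determines the
  number of generators in each degree (\<open>card_letters_eq_of_card_words_eq\<close>), so the latter is always the
  number of indecomposable words of length \<open>d\<close> (\<open>card_free_generators_of_degree\<close>).

  On the side of the Cayley graph, write a permutation \<open>g\<close> as the list \<open>g 1, \<dots>, g n\<close>. An edge labelled
  \<open>c\<^sub>k\<close> moves the \<open>k\<close>-th entry of this list to the front. Record the moved entries instead of the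
  labels; this is a bijection from walks of length \<open>d\<close> to words of length \<open>d\<close> over \<open>1, \<dots>, n\<close>. The final
  list consists of the moved entries, the latest one first, followed by the others in their original
  order. So the walk returns to the identity exactly if the recorded word, read backwards, has its
  letters first occurring in the order \<open>1, 2, 3, \<dots>\<close>, that is, if it is orbit-minimal
  (\<open>reduces_to_id_iff\<close>). Prefixes of the walk are suffixes of the word read backwards, hence the
  noncrossing words correspond to the indecomposable words.
\<close>

section \<open>Noncommutative polynomials as a rational vector space\<close>

abbreviation word_coeff :: "'a ncpoly \<Rightarrow> 'a list \<Rightarrow> rat" where
  "word_coeff p w \<equiv> Poly_Mapping.lookup p (NCMon w)"

lemma ncpoly_eqI:
  assumes "\<And>w. word_coeff p w = word_coeff q w"
  shows "p = q"
  by (rule poly_mapping_eqI) (metis assms ncmon.collapse)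

lemma homogeneous_iff:
  "homogeneous d p \<longleftrightarrow> (\<forall>w. length w \<noteq> d \<longrightarrow> word_coeff p w = 0)"
  unfolding homogeneous_def by (metis in_keys_iff ncmon.collapse ncmon.sel)

lemma free_algebra_iff:
  "p \<in> free_algebra X \<longleftrightarrow> (\<forall>w. w \<notin> lists X \<longrightarrow> word_coeff p w = 0)"
  unfolding free_algebra_def mem_Collect_eq Ball_def in_keys_iff in_lists_conv_set
  by (metis ncmon.collapse ncmon.sel subset_code(1))

text \<open>A word of length \<open>k\<close> has exactly \<open>k + 1\<close> factorizations into two words, one for each cutting
  position, so the convolution product becomes a finite sum over positions.\<close>

lemma word_coeff_times:
  "word_coeff (p * q) w = (\<Sum>i\<le>length w. word_coeff p (take i w) * word_coeff q (drop i w))"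
proof -
  let ?T = "\<lambda>i. NCMon (take i w)"
  let ?f = "\<lambda>l. Poly_Mapping.lookup p l * (\<Sum>r. Poly_Mapping.lookup q r when NCMon w = l + r)"
  have inj: "inj_on ?T {..length w}"
    by (rule inj_onI) (metis atMost_iff length_take min.absorb2 ncmon.inject)
  have inner: "?f (?T i) = word_coeff p (take i w) * word_coeff q (drop i w)" if "i \<le> length w" for i
  proof -
    have "NCMon w = ?T i + r \<longleftrightarrow> r = NCMon (drop i w)" for r
    proof -
      have "w = take i w @ v \<longleftrightarrow> v = drop i w" for v
        by (metis append_take_drop_id same_append_eq)
      then show ?thesis by (cases r) (simp add: plus_ncmon_def)
    qed
    then show ?thesis by simp
  qed
  have sup: "{l. ?f l \<noteq> 0} \<subseteq> ?T ` {..length w}"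
  proof
    fix l assume l: "l \<in> {l. ?f l \<noteq> 0}"
    have "\<exists>r. NCMon w = l + r"
    proof (rule ccontr)
      assume "\<nexists>r. NCMon w = l + r"
      then have "?f l = 0" by simp
      with l show False by simp
    qed
    then obtain r where "w = letters l @ letters r" by (auto simp: plus_ncmon_def)
    then have "l = ?T (length (letters l))" "length (letters l) \<le> length w" by auto
    then show "l \<in> ?T ` {..length w}" by blast
  qed
  have "word_coeff (p * q) w = (\<Sum>l. ?f l)" by (simp add: lookup_mult)
  also have "\<dots> = sum ?f (?T ` {..length w})"
    by (rule Sum_any.expand_superset) (use sup in auto)
  also have "\<dots> = (\<Sum>i\<le>length w. ?f (?T i))" by (simp only: sum.reindex[OF inj] comp_def)
  also have "\<dots> = (\<Sum>i\<le>length w. word_coeff p (take i w) * word_coeff q (drop i w))"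
    using inner by (intro sum.cong) auto
  finally show ?thesis .
qed

definition scale_nc :: "rat \<Rightarrow> 'a ncpoly \<Rightarrow> 'a ncpoly" where
  "scale_nc c p = Poly_Mapping.single 0 c * p"

lemma word_coeff_scale: "word_coeff (scale_nc c p) w = c * word_coeff p w"
proof -
  have "word_coeff (scale_nc c p) w =
      (\<Sum>i\<le>length w. if i = 0 then c * word_coeff p w else 0)"
    unfolding scale_nc_def word_coeff_times
    by (intro sum.cong) (auto simp: zero_ncmon_def lookup_single when_def)
  then show ?thesis by simp
qed

interpretation nc: vector_space scale_nc
  by unfold_locales
    (simp_all add: scale_nc_def distrib_left distrib_right single_add mult_single
      flip: mult.assoc)

lemma word_coeff_linear_sum:
  "word_coeff (\<Sum>i\<in>F. scale_nc (c i) (f i)) w = (\<Sum>i\<in>F. c i * word_coeff (f i) w)"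
  by (simp add: lookup_sum word_coeff_scale)

lemma homogeneous_times:
  assumes "homogeneous d p" "homogeneous e q"
  shows "homogeneous (d + e) (p * q)"
  unfolding homogeneous_iff
proof (intro allI impI)
  fix w :: "'a list" assume w: "length w \<noteq> d + e"
  have "word_coeff p (take i w) * word_coeff q (drop i w) = 0" if "i \<le> length w" for i
    using assms w that unfolding homogeneous_iff
    by (metis add_diff_inverse_nat length_drop length_take linorder_not_less min.absorb2 mult_eq_0_iff)
  then show "word_coeff (p * q) w = 0" unfolding word_coeff_times by (intro sum.neutral) auto
qed

text \<open>If the left factor is homogeneous, only one cutting position contributes. This is why a product
  of homogeneous polynomials has no cancellation at the concatenation of two minimal words.\<close>

lemma word_coeff_homogeneous_times:
  assumes "homogeneous d p" "length u = d"
  shows "word_coeff (p * q) (u @ v) = word_coeff p u * word_coeff q v"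
proof -
  let ?w = "u @ v"
  have "word_coeff p (take i ?w) * word_coeff q (drop i ?w) = 0" if "i \<le> length ?w" "i \<noteq> d" for i
  proof -
    have "length (take i ?w) = i" by (simp only: length_take min.absorb2[OF that(1)])
    then have "length (take i ?w) \<noteq> d" using that(2) by simp
    then show ?thesis using assms(1) unfolding homogeneous_iff by (metis mult_eq_0_iff)
  qed
  then have "word_coeff (p * q) ?w =
      (\<Sum>i\<le>length ?w. if i = d then word_coeff p u * word_coeff q v else 0)"
    unfolding word_coeff_times using assms(2) by (intro sum.cong) auto
  then show ?thesis using assms(2) by simp
qed

definition homogeneous_part :: "nat \<Rightarrow> 'a ncpoly \<Rightarrow> 'a ncpoly" where
  "homogeneous_part d p = (\<Sum>w\<in>{w \<in> Poly_Mapping.keys p. length (letters w) = d}.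
     Poly_Mapping.single w (Poly_Mapping.lookup p w))"

lemma word_coeff_homogeneous_part:
  "word_coeff (homogeneous_part d p) w = (if length w = d then word_coeff p w else 0)"
proof -
  have "word_coeff (homogeneous_part d p) w =
      (\<Sum>v\<in>{v \<in> Poly_Mapping.keys p. length (letters v) = d}.
         if v = NCMon w then word_coeff p w else 0)"
    unfolding homogeneous_part_def lookup_sum
    by (intro sum.cong) (auto simp: lookup_single when_def)
  also have "\<dots> = (if length w = d then word_coeff p w else 0)"
    by (auto simp: sum.delta in_keys_iff)
  finally show ?thesis .
qed

lemma homogeneous_part_of_homogeneous:
  assumes "homogeneous e p"
  shows "homogeneous_part d p = (if d = e then p else 0)"
  by (rule ncpoly_eqI) (use assms in \<open>auto simp: word_coeff_homogeneous_part homogeneous_iff\<close>)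

text \<open>Taking the homogeneous part is linear and sends each homogeneous spanning vector either to itself
  or to zero. It is used to show that a degree \<open>d\<close> invariant is a combination of those products of
  generators that themselves have degree \<open>d\<close>.\<close>

lemma homogeneous_part_mem_span:
  assumes hom: "\<And>s. s \<in> S \<Longrightarrow> \<exists>e. homogeneous e s"
    and "p \<in> nc.span S"
  shows "homogeneous_part d p \<in> nc.span {s \<in> S. homogeneous d s}"
  using assms(2)
proof (induction rule: nc.span_induct_alt)
  case base
  have "homogeneous_part d 0 = (0 :: 'a ncpoly)"
    by (rule ncpoly_eqI) (simp add: word_coeff_homogeneous_part)
  then show ?case by (simp add: nc.span_zero)
next
  case (step c x y)
  obtain e where e: "homogeneous e x" using hom step(1) by blast
  have lin: "homogeneous_part d (scale_nc c x + y)
      = scale_nc c (homogeneous_part d x) + homogeneous_part d y"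
    by (rule ncpoly_eqI)
      (simp add: word_coeff_homogeneous_part lookup_add word_coeff_scale)
  have "homogeneous_part d x \<in> nc.span {s \<in> S. homogeneous d s}"
    using homogeneous_part_of_homogeneous[OF e, of d] step(1) e
    by (auto intro: nc.span_base nc.span_zero)
  then show ?case unfolding lin using step(2) by (intro nc.span_add nc.span_scale)
qed

text \<open>A family that repeats a vector is dependent, whereas its image, as a set, need not be; hence the
  injectivity next to independence of the image. Linear independence of the products of generators
  is naturally a property of the family indexed by words.\<close>

lemma (in vector_space) independent_family_iff:
  "inj_on f I \<and> independent (f ` I) \<longleftrightarrow>
    (\<forall>F c. finite F \<longrightarrow> F \<subseteq> I \<longrightarrow> (\<Sum>i\<in>F. scale (c i) (f i)) = 0 \<longrightarrow> (\<forall>i\<in>F. c i = 0))"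
  (is "?L \<longleftrightarrow> ?R")
proof
  assume L: ?L
  show ?R
  proof (intro allI impI ballI)
    fix F c i
    assume F: "finite F" "F \<subseteq> I" "(\<Sum>i\<in>F. scale (c i) (f i)) = 0" "i \<in> F"
    have inj: "inj_on f F" using L F(2) inj_on_subset by blast
    have "(\<Sum>v\<in>f ` F. scale (c (the_inv_into F f v)) v) = (\<Sum>i\<in>F. scale (c i) (f i))"
      by (subst sum.reindex[OF inj]) (auto intro!: sum.cong simp: the_inv_into_f_f[OF inj])
    then have "c (the_inv_into F f (f i)) = 0"
      using L F by (intro independentD[of "f ` I" "f ` F" _ "f i"]) auto
    then show "c i = 0" using the_inv_into_f_f[OF inj F(4)] by simp
  qed
next
  assume R: ?R
  have inj: "inj_on f I"
  proof (rule inj_onI, rule ccontr)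
    fix i j assume ij: "i \<in> I" "j \<in> I" "f i = f j" "i \<noteq> j"
    \<comment> \<open>a repeated vector gives the relation \<open>f i - f j = 0\<close>\<close>
    let ?c = "\<lambda>k. if k = i then 1 else - 1 :: 'a"
    have "(\<Sum>k\<in>{i, j}. scale (?c k) (f k)) = 0" using ij by simp
    then have "?c i = 0" using R[rule_format, of "{i, j}" ?c i] ij by auto
    then show False by simp
  qed
  have "independent (f ` I)"
    unfolding independent_explicit_module
  proof (intro allI impI)
    fix T u v assume T: "finite T" "T \<subseteq> f ` I" "(\<Sum>v\<in>T. scale (u v) v) = 0" "v \<in> T"
    obtain F where F: "F \<subseteq> I" "T = f ` F" using T(2) subset_image_iff by metis
    have injF: "inj_on f F" using inj F(1) inj_on_subset by blast
    have "finite F" using T(1) F(2) injF finite_image_iff by blast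
    moreover have "(\<Sum>i\<in>F. scale (u (f i)) (f i)) = 0"
      using T(3) F(2) by (simp add: sum.reindex[OF injF])
    ultimately have "\<forall>i\<in>F. u (f i) = 0" using R[rule_format, of F "u \<circ> f"] F(1) by auto
    then show "u v = 0" using T(4) F(2) by auto
  qed
  with inj show ?L by simp
qed

lemma (in vector_space) span_subset_span_of_card_eq:
  assumes T: "finite T" and S: "independent S" "S \<subseteq> span T" and card: "card T = card S"
  shows "span T \<subseteq> span S"
proof -
  have "x \<in> span S" if "x \<in> T" for x
  proof (rule ccontr)
    assume x: "x \<notin> span S"
    have fin: "finite S" using independent_span_bound[OF T S] by simp
    have "card (insert x S) \<le> card T"
      using independent_span_bound[OF T, of "insert x S"] x S that
      by (simp add: independent_insert span_base)
    moreover have "x \<notin> S" using x span_base by blast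
    ultimately show False using card fin by simp
  qed
  then show ?thesis by (intro span_minimal) auto
qed

text \<open>Triangularity: in a linear relation, look at the smallest of the words \<open>l i\<close> whose index has a
  nonzero coefficient. No other term of the relation involves that word, so it cannot cancel.\<close>

lemma independent_of_distinct_min_words:
  fixes f :: "'i \<Rightarrow> 'a::linorder ncpoly"
  assumes inj: "inj_on l I"
    and lead: "\<And>i. i \<in> I \<Longrightarrow> word_coeff (f i) (l i) \<noteq> 0"
    and least: "\<And>i w. i \<in> I \<Longrightarrow> w < l i \<Longrightarrow> word_coeff (f i) w = 0"
  shows "inj_on f I \<and> nc.independent (f ` I)"
  unfolding nc.independent_family_iff
proof (intro allI impI, rule ccontr)
  fix F c
  assume F: "finite F" "F \<subseteq> I" and zero: "(\<Sum>i\<in>F. scale_nc (c i) (f i)) = 0"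
    and "\<not> (\<forall>i\<in>F. c i = 0)"
  define G where "G = {i \<in> F. c i \<noteq> 0}"
  have G: "finite (l ` G)" "l ` G \<noteq> {}" using F \<open>\<not> (\<forall>i\<in>F. c i = 0)\<close> by (auto simp: G_def)
  obtain i where i: "i \<in> G" "l i = Min (l ` G)" using Min_in[OF G] by fastforce
  have other: "c j * word_coeff (f j) (l i) = 0" if j: "j \<in> F" "j \<noteq> i" for j
  proof (cases "j \<in> G")
    case True
    have "l i \<le> l j" using G(1) True i(2) by simp
    moreover have "l i \<noteq> l j" using inj j i(1) F(2) unfolding G_def inj_on_def by blast
    ultimately have "word_coeff (f j) (l i) = 0" using least[of j "l i"] j(1) F(2) by auto
    then show ?thesis by simp
  next
    case False
    then show ?thesis using j by (simp add: G_def)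
  qed
  have "i \<in> F" using i G_def by simp
  have "0 = (\<Sum>j\<in>F. c j * word_coeff (f j) (l i))"
    using zero word_coeff_linear_sum[of c f F "l i"] by simp
  also have "\<dots> = c i * word_coeff (f i) (l i)"
  proof -
    have "(\<Sum>j\<in>F - {i}. c j * word_coeff (f j) (l i)) = 0"
      using other by (intro sum.neutral) blast
    then show ?thesis
      using sum.remove[OF F(1) \<open>i \<in> F\<close>, of "\<lambda>j. c j * word_coeff (f j) (l i)"] by simp
  qed
  finally show False using lead[of i] i(1) F(2) by (auto simp: G_def)
qed

section \<open>Free generating sets and bases of products\<close>

lemma eval_nc_sum:
  assumes "finite K" "Poly_Mapping.keys P \<subseteq> NCMon ` K"
  shows "eval_nc P = (\<Sum>W\<in>K. scale_nc (word_coeff P W) (prod_list W))"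
proof -
  let ?g = "\<lambda>X. scale_nc (Poly_Mapping.lookup P X) (prod_list (letters X))"
  have "eval_nc P = sum ?g (Poly_Mapping.keys P)"
    unfolding eval_nc_def scale_nc_def ..
  also have "\<dots> = sum ?g (NCMon ` K)"
    using assms by (intro sum.mono_neutral_left) (auto simp: in_keys_iff)
  also have "\<dots> = (\<Sum>W\<in>K. scale_nc (word_coeff P W) (prod_list W))"
    by (subst sum.reindex) (auto simp: inj_on_def)
  finally show ?thesis .
qed

lemma ncpoly_with_coeffs:
  fixes c :: "'a list \<Rightarrow> rat"
  assumes "finite F"
  obtains P where "\<And>W. word_coeff P W = (if W \<in> F then c W else 0)"
proof
  fix W
  have "word_coeff (\<Sum>V\<in>F. Poly_Mapping.single (NCMon V) (c V)) W
      = (\<Sum>V\<in>F. if V = W then c W else 0)"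
    unfolding lookup_sum by (intro sum.cong) (auto simp: lookup_single when_def)
  then show "word_coeff (\<Sum>V\<in>F. Poly_Mapping.single (NCMon V) (c V)) W = (if W \<in> F then c W else 0)"
    using assms by simp
qed

lemma eval_nc_of_coeffs:
  assumes "finite F" "\<And>W. word_coeff P W = (if W \<in> F then c W else 0)"
  shows "eval_nc P = (\<Sum>W\<in>F. scale_nc (c W) (prod_list W))"
proof -
  have "Poly_Mapping.keys P \<subseteq> NCMon ` F"
  proof
    fix x assume "x \<in> Poly_Mapping.keys P"
    then have "word_coeff P (letters x) \<noteq> 0" by (simp add: in_keys_iff)
    then have "letters x \<in> F" using assms(2)[of "letters x"] by (auto split: if_splits)
    then show "x \<in> NCMon ` F" by (metis image_eqI ncmon.collapse)
  qed
  from eval_nc_sum[OF assms(1) this] show ?thesis by (simp add: assms(2))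
qed

lemma eval_nc_image_free_algebra:
  "eval_nc ` free_algebra B = nc.span (prod_list ` lists B)"
proof
  show "eval_nc ` free_algebra B \<subseteq> nc.span (prod_list ` lists B)"
  proof
    fix p assume "p \<in> eval_nc ` free_algebra B"
    then obtain P where P: "P \<in> free_algebra B" "p = eval_nc P" by blast
    let ?K = "letters ` Poly_Mapping.keys P"
    have "?K \<subseteq> lists B" using P(1) by (auto simp: free_algebra_def)
    moreover have "p = (\<Sum>W\<in>?K. scale_nc (word_coeff P W) (prod_list W))"
      unfolding P(2) by (rule eval_nc_sum) (auto simp: image_image)
    ultimately show "p \<in> nc.span (prod_list ` lists B)"
      by (auto intro!: nc.span_sum nc.span_scale intro: nc.span_base)
  qed
  show "nc.span (prod_list ` lists B) \<subseteq> eval_nc ` free_algebra B"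
  proof
    fix p assume "p \<in> nc.span (prod_list ` lists B)"
    then obtain T r where T: "finite T" "T \<subseteq> prod_list ` lists B" "p = (\<Sum>a\<in>T. scale_nc (r a) a)"
      unfolding nc.span_explicit by blast
    obtain F where F: "F \<subseteq> lists B" "inj_on prod_list F" "T = prod_list ` F"
      using T(2) subset_image_inj by metis
    have finF: "finite F" using T(1) F finite_image_iff by blast
    obtain P where P: "\<And>W. word_coeff P W = (if W \<in> F then r (prod_list W) else 0)"
      using ncpoly_with_coeffs[OF finF, of "\<lambda>W. r (prod_list W)"] by blast
    have "P \<in> free_algebra B" unfolding free_algebra_iff P using F(1) by auto
    moreover have "eval_nc P = p"
      unfolding eval_nc_of_coeffs[OF finF P] T(3) F(3) by (simp add: sum.reindex[OF F(2)])
    ultimately show "p \<in> eval_nc ` free_algebra B" by blast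
  qed
qed

text \<open>A relation between products of elements of \<open>B\<close> is the same as a pair of noncommutative polynomials
  in the letters \<open>B\<close> with equal values.\<close>

lemma inj_on_eval_nc_iff:
  "inj_on eval_nc (free_algebra B) \<longleftrightarrow>
    inj_on prod_list (lists B) \<and> nc.independent (prod_list ` lists B)"
  unfolding nc.independent_family_iff
proof (intro iffI allI impI ballI)
  fix F and c :: "'a ncpoly list \<Rightarrow> rat" and W
  assume inj: "inj_on eval_nc (free_algebra B)" and F: "finite F" "F \<subseteq> lists B"
    and zero: "(\<Sum>W\<in>F. scale_nc (c W) (prod_list W)) = 0" and W: "W \<in> F"
  obtain P where P: "\<And>W. word_coeff P W = (if W \<in> F then c W else 0)"
    using ncpoly_with_coeffs[OF F(1)] by blast
  have "P \<in> free_algebra B" unfolding free_algebra_iff P using F(2) by auto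
  moreover have "eval_nc P = eval_nc 0"
    unfolding eval_nc_of_coeffs[OF F(1) P] zero by (simp add: eval_nc_def)
  moreover have "0 \<in> free_algebra B" by (simp add: free_algebra_def)
  ultimately have "P = 0" using inj by (simp add: inj_on_def)
  then show "c W = 0" using P[of W] W by simp
next
  assume R: "\<forall>F c. finite F \<longrightarrow> F \<subseteq> lists B \<longrightarrow> (\<Sum>W\<in>F. scale_nc (c W) (prod_list W)) = 0
      \<longrightarrow> (\<forall>W\<in>F. c W = 0)"
  show "inj_on eval_nc (free_algebra B)"
  proof (rule inj_onI)
    fix P Q :: "'a ncpoly ncpoly"
    assume PQ: "P \<in> free_algebra B" "Q \<in> free_algebra B" "eval_nc P = eval_nc Q"
    let ?F = "letters ` (Poly_Mapping.keys P \<union> Poly_Mapping.keys Q)"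
    let ?c = "\<lambda>W. word_coeff P W - word_coeff Q W"
    have fin: "finite ?F" by simp
    have sub: "?F \<subseteq> lists B" using PQ(1,2) by (auto simp: free_algebra_def)
    have keys: "Poly_Mapping.keys P \<subseteq> NCMon ` ?F" "Poly_Mapping.keys Q \<subseteq> NCMon ` ?F"
      by (auto simp: image_image)
    have "(\<Sum>W\<in>?F. scale_nc (?c W) (prod_list W)) = eval_nc P - eval_nc Q"
      unfolding eval_nc_sum[OF fin keys(1)] eval_nc_sum[OF fin keys(2)]
      by (simp add: sum_subtractf nc.scale_left_diff_distrib)
    then have "(\<Sum>W\<in>?F. scale_nc (?c W) (prod_list W)) = 0" using PQ(3) by simp
    then have zero: "\<forall>W\<in>?F. ?c W = 0" by (rule R[rule_format, OF fin sub, THEN ballI])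
    show "P = Q"
    proof (rule ncpoly_eqI)
      fix W
      show "word_coeff P W = word_coeff Q W"
      proof (cases "W \<in> ?F")
        case True
        then show ?thesis using bspec[OF zero True] by simp
      next
        case False
        then have "NCMon W \<notin> Poly_Mapping.keys P" "NCMon W \<notin> Poly_Mapping.keys Q"
          by (metis UnI1 image_eqI ncmon.sel, metis UnI2 image_eqI ncmon.sel)
        then show ?thesis by (simp add: in_keys_iff)
      qed
    qed
  qed
qed

text \<open>The free algebra on \<open>B\<close> has the words over \<open>B\<close> as a basis, and evaluation is linear. So it is a
  bijection onto \<open>A\<close> exactly if it maps these words to a basis of \<open>A\<close>. This turns both halves of
  the theorem, existence and counting of generators, into linear algebra.\<close>

lemma free_generating_set_iff_basis:
  "free_generating_set A B \<longleftrightarrow>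
    inj_on prod_list (lists B) \<and> nc.independent (prod_list ` lists B) \<and>
    nc.span (prod_list ` lists B) = A"
  unfolding free_generating_set_def bij_betw_def inj_on_eval_nc_iff eval_nc_image_free_algebra by auto

section \<open>Words that are minimal in their orbit\<close>

lemma append_less_append_iff:
  fixes x y :: "'a::linorder list"
  assumes "length x = length x'"
  shows "x @ y < x' @ y' \<longleftrightarrow> x < x' \<or> x = x' \<and> y < y'"
  using assms by (induction x x' rule: list_induct2) auto

lemma append_le_append_iff:
  fixes x y :: "'a::linorder list"
  assumes "length x = length x'"
  shows "x @ y \<le> x' @ y' \<longleftrightarrow> x < x' \<or> x = x' \<and> y \<le> y'"
  using append_less_append_iff[OF assms] assms by (auto simp: le_less)

text \<open>For this group these are the restricted growth words with letters at most \<open>n\<close>, that is, the words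
  encoding set partitions into at most \<open>n\<close> blocks. Defining them by minimality makes the closure
  properties below and the uniqueness of orbit representatives immediate; the description by first
  occurrences is needed only for the comparison with the Cayley graph.\<close>

definition orbit_minimal_words :: "nat \<Rightarrow> nat list set" where
  "orbit_minimal_words n = {u \<in> lists {1..n}. \<forall>\<sigma>. \<sigma> permutes {1..n} \<longrightarrow> u \<le> map \<sigma> u}"

lemma Nil_orbit_minimal: "[] \<in> orbit_minimal_words n"
  by (simp add: orbit_minimal_words_def)

text \<open>Together with \<open>orbit_minimal_prefix\<close>: a permutation acts letter by letter, and words of equal
  length are compared at their first difference. Hence it can improve \<open>u v\<close> only by improving \<open>u\<close> or,
  while fixing \<open>u\<close>, by improving \<open>v\<close>; and any improvement of \<open>u\<close> improves \<open>u v\<close>.\<close>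

lemma orbit_minimal_append:
  "u \<in> orbit_minimal_words n \<Longrightarrow> v \<in> orbit_minimal_words n \<Longrightarrow> u @ v \<in> orbit_minimal_words n"
  unfolding orbit_minimal_words_def
proof (intro CollectI conjI allI impI)
  fix \<sigma> assume "\<sigma> permutes {1..n}"
    and "u \<in> {u \<in> lists {1..n}. \<forall>\<sigma>. \<sigma> permutes {1..n} \<longrightarrow> u \<le> map \<sigma> u}"
      "v \<in> {u \<in> lists {1..n}. \<forall>\<sigma>. \<sigma> permutes {1..n} \<longrightarrow> u \<le> map \<sigma> u}"
  then have "u \<le> map \<sigma> u" "v \<le> map \<sigma> v" by blast+
  then show "u @ v \<le> map \<sigma> (u @ v)"
    using append_le_append_iff[of u "map \<sigma> u" v "map \<sigma> v"] unfolding le_less by auto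
qed auto

lemma orbit_minimal_prefix:
  "u @ v \<in> orbit_minimal_words n \<Longrightarrow> u \<in> orbit_minimal_words n"
  by (auto simp: orbit_minimal_words_def append_le_append_iff)

lemma map_permutes_lists:
  assumes "\<sigma> permutes A"
  shows "map \<sigma> w \<in> lists A \<longleftrightarrow> w \<in> lists A"
  using permutes_in_image[OF assms] by (auto simp: in_lists_conv_set)

lemma map_map_inv_permutes:
  assumes "\<sigma> permutes A"
  shows "map \<sigma> (map (inv \<sigma>) w) = w" "map (inv \<sigma>) (map \<sigma> w) = w"
  using permutes_inverses[OF assms] by (simp_all add: comp_def)

lemma ex_orbit_minimal:
  assumes "w \<in> lists {1..n}"
  obtains \<sigma> where "\<sigma> permutes {1..n}" "map \<sigma> w \<in> orbit_minimal_words n"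
proof -
  let ?O = "(\<lambda>\<sigma>. map \<sigma> w) ` {\<sigma>. \<sigma> permutes {1..n}}"
  have fin: "finite ?O" by (simp add: finite_permutations)
  have "?O \<noteq> {}" using permutes_id by blast
  with fin have "Min ?O \<in> ?O" by (rule Min_in)
  then obtain \<sigma> where \<sigma>: "\<sigma> permutes {1..n}" "Min ?O = map \<sigma> w" by auto
  have "map \<sigma> w \<le> map \<tau> (map \<sigma> w)" if "\<tau> permutes {1..n}" for \<tau>
  proof -
    have "map (\<tau> \<circ> \<sigma>) w \<in> ?O" using permutes_compose[OF \<sigma>(1) that] by blast
    then show ?thesis using Min_le[OF fin] \<sigma>(2) by (metis map_map)
  qed
  then have "map \<sigma> w \<in> orbit_minimal_words n"
    using assms map_permutes_lists[OF \<sigma>(1), of w] by (simp add: orbit_minimal_words_def)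
  with \<sigma>(1) that show thesis by blast
qed

lemma orbit_minimal_unique:
  assumes "u \<in> orbit_minimal_words n" "map \<sigma> u \<in> orbit_minimal_words n" "\<sigma> permutes {1..n}"
  shows "map \<sigma> u = u"
proof (rule antisym)
  show "u \<le> map \<sigma> u" using assms by (simp add: orbit_minimal_words_def)
  have "map \<sigma> u \<le> map (inv \<sigma>) (map \<sigma> u)"
    using assms(2) permutes_inv[OF assms(3)] unfolding orbit_minimal_words_def by blast
  then show "map \<sigma> u \<le> u" by (simp only: map_map_inv_permutes[OF assms(3)])
qed

section \<open>Invariants and orbit sums\<close>

text \<open>Injectivity of \<open>\<sigma>\<close> guarantees that no two words of \<open>p\<close> are merged.\<close>

lemma word_coeff_diag_act:
  assumes "inj \<sigma>"
  shows "word_coeff (diag_act \<sigma> p) (map \<sigma> w) = word_coeff p w"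
proof -
  have "word_coeff (diag_act \<sigma> p) (map \<sigma> w) =
      (\<Sum>v\<in>Poly_Mapping.keys p. if v = NCMon w then word_coeff p w else 0)"
    unfolding diag_act_def lookup_sum
  proof (rule sum.cong[OF refl])
    fix v :: "nat ncmon"
    have "map \<sigma> (letters v) = map \<sigma> w \<longleftrightarrow> v = NCMon w"
      using assms by (cases v) (simp add: inj_map_eq_map)
    then show "word_coeff (Poly_Mapping.single (NCMon (map \<sigma> (letters v))) (Poly_Mapping.lookup p v))
        (map \<sigma> w) = (if v = NCMon w then word_coeff p w else 0)"
      by (simp add: lookup_single when_def)
  qed
  also have "\<dots> = word_coeff p w" by (simp add: sum.delta in_keys_iff)
  finally show ?thesis .
qed

lemma invariant_algebra_iff:
  "p \<in> invariant_algebra n \<longleftrightarrow>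
    (\<forall>w. w \<notin> lists {1..n} \<longrightarrow> word_coeff p w = 0) \<and>
    (\<forall>\<sigma> w. \<sigma> permutes {1..n} \<longrightarrow> word_coeff p (map \<sigma> w) = word_coeff p w)"
proof -
  have "diag_act \<sigma> p = p \<longleftrightarrow> (\<forall>w. word_coeff p (map \<sigma> w) = word_coeff p w)"
    if \<sigma>: "\<sigma> permutes {1..n}" for \<sigma>
  proof
    assume "diag_act \<sigma> p = p"
    then show "\<forall>w. word_coeff p (map \<sigma> w) = word_coeff p w"
      using word_coeff_diag_act[OF permutes_inj[OF \<sigma>], of p] by simp
  next
    assume inv: "\<forall>w. word_coeff p (map \<sigma> w) = word_coeff p w"
    show "diag_act \<sigma> p = p"
    proof (rule ncpoly_eqI)
      fix w
      have "word_coeff (diag_act \<sigma> p) (map \<sigma> (map (inv \<sigma>) w)) = word_coeff p (map \<sigma> (map (inv \<sigma>) w))"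
        unfolding word_coeff_diag_act[OF permutes_inj[OF \<sigma>]] by (rule inv[rule_format, symmetric])
      then show "word_coeff (diag_act \<sigma> p) w = word_coeff p w"
        by (simp only: map_map_inv_permutes[OF \<sigma>])
    qed
  qed
  then show ?thesis
    unfolding invariant_algebra_def tensor_algebra_def mem_Collect_eq free_algebra_iff by blast
qed

lemma subspace_invariant_algebra: "nc.subspace (invariant_algebra n)"
  by (rule nc.subspaceI) (auto simp: invariant_algebra_iff lookup_add word_coeff_scale)

lemma one_in_invariant_algebra: "1 \<in> invariant_algebra n"
  by (auto simp: invariant_algebra_iff lookup_one zero_ncmon_def when_def)

lemma times_in_invariant_algebra:
  assumes "p \<in> invariant_algebra n" "q \<in> invariant_algebra n"
  shows "p * q \<in> invariant_algebra n"
  unfolding invariant_algebra_iff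
proof (intro conjI allI impI)
  fix w assume w: "w \<notin> lists {1..n}"
  have zero: "word_coeff p (take i w) * word_coeff q (drop i w) = 0" for i
  proof -
    have "take i w \<notin> lists {1..n} \<or> drop i w \<notin> lists {1..n}"
      using w by (metis append_in_lists_conv append_take_drop_id)
    then show ?thesis using assms by (auto simp: invariant_algebra_iff)
  qed
  show "word_coeff (p * q) w = 0"
    unfolding word_coeff_times by (intro sum.neutral ballI zero)
next
  fix \<sigma> w assume "\<sigma> permutes {1..n}"
  then show "word_coeff (p * q) (map \<sigma> w) = word_coeff (p * q) w"
    using assms by (simp add: word_coeff_times invariant_algebra_iff take_map drop_map)
qed

definition orbit_sum :: "nat \<Rightarrow> nat list \<Rightarrow> nat ncpoly" where
  "orbit_sum n u = (\<Sum>w\<in>(\<lambda>\<sigma>. map \<sigma> u) ` {\<sigma>. \<sigma> permutes {1..n}}. Poly_Mapping.single (NCMon w) 1)"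

lemma word_coeff_orbit_sum:
  "word_coeff (orbit_sum n u) w = (if \<exists>\<sigma>. \<sigma> permutes {1..n} \<and> w = map \<sigma> u then 1 else 0)"
proof -
  let ?O = "(\<lambda>\<sigma>. map \<sigma> u) ` {\<sigma>. \<sigma> permutes {1..n}}"
  have "word_coeff (orbit_sum n u) w = (\<Sum>v\<in>?O. if v = w then 1 else 0)"
    unfolding orbit_sum_def lookup_sum by (intro sum.cong) (auto simp: lookup_single when_def)
  also have "\<dots> = (if w \<in> ?O then 1 else 0)"
    by (simp add: finite_permutations)
  finally show ?thesis by auto
qed

lemma orbit_sum_invariant:
  assumes "u \<in> lists {1..n}"
  shows "orbit_sum n u \<in> invariant_algebra n"
  unfolding invariant_algebra_iff
proof (intro conjI allI impI)
  fix w assume "w \<notin> lists {1..n}"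
  then have "\<nexists>\<sigma>. \<sigma> permutes {1..n} \<and> w = map \<sigma> u" using assms map_permutes_lists by blast
  then show "word_coeff (orbit_sum n u) w = 0" by (simp add: word_coeff_orbit_sum)
next
  fix \<sigma> w assume \<sigma>: "\<sigma> permutes {1..n}"
  have "(\<exists>\<tau>. \<tau> permutes {1..n} \<and> map \<sigma> w = map \<tau> u) \<longleftrightarrow> (\<exists>\<tau>. \<tau> permutes {1..n} \<and> w = map \<tau> u)"
  proof (safe)
    fix \<tau> assume \<tau>: "\<tau> permutes {1..n}" "map \<sigma> w = map \<tau> u"
    have "w = map (inv \<sigma> \<circ> \<tau>) u"
      using map_map_inv_permutes(2)[OF \<sigma>, of w] \<tau>(2) by (metis map_map)
    then show "\<exists>\<tau>. \<tau> permutes {1..n} \<and> w = map \<tau> u"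
      using permutes_compose[OF \<tau>(1) permutes_inv[OF \<sigma>]] by blast
  next
    fix \<tau> assume \<tau>: "\<tau> permutes {1..n}"
    show "\<exists>\<tau>'. \<tau>' permutes {1..n} \<and> map \<sigma> (map \<tau> u) = map \<tau>' u"
      using permutes_compose[OF \<tau> \<sigma>] by (intro exI[of _ "\<sigma> \<circ> \<tau>"]) simp
  qed
  then show "word_coeff (orbit_sum n u) (map \<sigma> w) = word_coeff (orbit_sum n u) w"
    by (simp add: word_coeff_orbit_sum)
qed

text \<open>An invariant has constant coefficients on each orbit, and every orbit contains exactly one
  orbit-minimal word.\<close>

lemma invariant_eq_sum_of_orbit_sums:
  assumes p: "p \<in> invariant_algebra n"
  shows "p = (\<Sum>u\<in>{u \<in> orbit_minimal_words n. NCMon u \<in> Poly_Mapping.keys p}.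
    scale_nc (word_coeff p u) (orbit_sum n u))" (is "p = sum ?t ?U")
proof (rule ncpoly_eqI)
  fix w
  have fin: "finite ?U"
    by (rule finite_subset[of _ "letters ` Poly_Mapping.keys p"]) (auto simp: image_iff, force)
  have coeff: "word_coeff (sum ?t ?U) w = (\<Sum>u\<in>?U. word_coeff p u * word_coeff (orbit_sum n u) w)"
    by (rule word_coeff_linear_sum)
  show "word_coeff p w = word_coeff (sum ?t ?U) w"
  proof (cases "w \<in> lists {1..n}")
    case False
    have "word_coeff (orbit_sum n u) w = 0" if "u \<in> ?U" for u
      using that False orbit_sum_invariant[of u n]
      by (auto simp: orbit_minimal_words_def invariant_algebra_iff)
    then show ?thesis using False p unfolding coeff by (simp add: invariant_algebra_iff)
  next
    case True
    obtain \<sigma> where \<sigma>: "\<sigma> permutes {1..n}" "map \<sigma> w \<in> orbit_minimal_words n"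
      using ex_orbit_minimal[OF True] .
    let ?u = "map \<sigma> w"
    have w: "w = map (inv \<sigma>) ?u" by (simp only: map_map_inv_permutes[OF \<sigma>(1)])
    have in_orbit: "word_coeff (orbit_sum n ?u) w = 1"
      using permutes_inv[OF \<sigma>(1)] w by (auto simp: word_coeff_orbit_sum)
    have other: "word_coeff (orbit_sum n u) w = 0" if u: "u \<in> ?U" "u \<noteq> ?u" for u
    proof (rule ccontr)
      assume "word_coeff (orbit_sum n u) w \<noteq> 0"
      then obtain \<tau> where \<tau>: "\<tau> permutes {1..n}" "w = map \<tau> u"
        by (auto simp: word_coeff_orbit_sum split: if_splits)
      have "map (\<sigma> \<circ> \<tau>) u = u"
        using u(1) \<sigma>(2) \<tau>(2) permutes_compose[OF \<tau>(1) \<sigma>(1)] by (intro orbit_minimal_unique) auto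
      then show False using \<tau>(2) u(2) by simp
    qed
    have "(\<Sum>u\<in>?U. word_coeff p u * word_coeff (orbit_sum n u) w)
        = (\<Sum>u\<in>?U. if u = ?u then word_coeff p ?u else 0)"
      using other in_orbit by (intro sum.cong) auto
    also have "\<dots> = word_coeff p ?u" using fin \<sigma>(2) by (simp add: sum.delta in_keys_iff)
    also have "\<dots> = word_coeff p w" using p \<sigma>(1) by (simp add: invariant_algebra_iff)
    finally show ?thesis unfolding coeff by simp
  qed
qed

section \<open>Minimal words of polynomials\<close>

text \<open>Homogeneity is included because it makes minimal words multiplicative: without it, words of different
  lengths could cancel the concatenation of the two minimal words.\<close>

definition has_min_word :: "'a::linorder list \<Rightarrow> 'a ncpoly \<Rightarrow> bool" where
  "has_min_word u p \<longleftrightarrow>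
    homogeneous (length u) p \<and> word_coeff p u \<noteq> 0 \<and> (\<forall>w<u. word_coeff p w = 0)"

lemma has_min_word_one: "has_min_word [] 1"
  by (auto simp: has_min_word_def homogeneous_iff lookup_one zero_ncmon_def when_def)

text \<open>A word below \<open>u v\<close> of the same length either begins with a word below \<open>u\<close>, or begins with \<open>u\<close> and
  ends with a word below \<open>v\<close>. In both cases one of the two factors has coefficient zero.\<close>

lemma has_min_word_times:
  assumes p: "has_min_word u p" and q: "has_min_word v q"
  shows "has_min_word (u @ v) (p * q)"
proof -
  have hp: "homogeneous (length u) p" and hq: "homogeneous (length v) q"
    using p q by (auto simp: has_min_word_def)
  have hom: "homogeneous (length (u @ v)) (p * q)" using homogeneous_times[OF hp hq] by simp
  have lead: "word_coeff (p * q) (u @ v) \<noteq> 0"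
    using p q word_coeff_homogeneous_times[OF hp refl, of q v] by (auto simp: has_min_word_def)
  have "word_coeff (p * q) w = 0" if w: "w < u @ v" for w
  proof (cases "length w = length (u @ v)")
    case False
    then show ?thesis using hom by (simp add: homogeneous_iff)
  next
    case True
    define x y where "x = take (length u) w" and "y = drop (length u) w"
    have xy: "w = x @ y" "length x = length u" using True by (auto simp: x_def y_def)
    then have "x < u \<or> y < v" using w append_less_append_iff[OF xy(2)] by auto
    then show ?thesis
      using p q word_coeff_homogeneous_times[OF hp xy(2), of q y] xy(1)
      by (auto simp: has_min_word_def)
  qed
  with hom lead show ?thesis by (simp add: has_min_word_def)
qed

lemma has_min_word_orbit_sum:
  assumes "u \<in> orbit_minimal_words n"
  shows "has_min_word u (orbit_sum n u)"
  unfolding has_min_word_def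
proof (intro conjI allI impI)
  show "homogeneous (length u) (orbit_sum n u)"
    by (auto simp: homogeneous_iff word_coeff_orbit_sum)
  have "\<exists>\<sigma>. \<sigma> permutes {1..n} \<and> u = map \<sigma> u"
    by (intro exI[of _ id] conjI permutes_id) simp
  then show "word_coeff (orbit_sum n u) u \<noteq> 0" by (simp only: word_coeff_orbit_sum) simp
  fix w assume "w < u"
  then show "word_coeff (orbit_sum n u) w = 0"
    using assms by (fastforce simp: word_coeff_orbit_sum orbit_minimal_words_def)
qed

lemma independent_of_has_min_word:
  fixes f :: "'i \<Rightarrow> 'a::linorder ncpoly"
  assumes "inj_on l I" "\<And>i. i \<in> I \<Longrightarrow> has_min_word (l i) (f i)"
  shows "inj_on f I \<and> nc.independent (f ` I)"
  by (rule independent_of_distinct_min_words[OF assms(1)])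
    (use assms(2) in \<open>auto simp: has_min_word_def\<close>)

section \<open>Orbit sums as a basis\<close>

lemma span_orbit_sums: "nc.span (orbit_sum n ` orbit_minimal_words n) = invariant_algebra n"
proof (rule nc.span_unique)
  show "orbit_sum n ` orbit_minimal_words n \<subseteq> invariant_algebra n"
    using orbit_sum_invariant by (auto simp: orbit_minimal_words_def)
  show "nc.subspace (invariant_algebra n)" by (rule subspace_invariant_algebra)
  fix S assume S: "orbit_sum n ` orbit_minimal_words n \<subseteq> S" "nc.subspace S"
  show "invariant_algebra n \<subseteq> S"
  proof
    fix p assume "p \<in> invariant_algebra n"
    from invariant_eq_sum_of_orbit_sums[OF this] show "p \<in> S"
      by (rule ssubst) (use S in \<open>auto intro!: nc.subspace_sum nc.subspace_scale\<close>)
  qed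
qed

abbreviation orbit_sums_of_degree :: "nat \<Rightarrow> nat \<Rightarrow> nat ncpoly set" where
  "orbit_sums_of_degree n d \<equiv> orbit_sum n ` {u \<in> orbit_minimal_words n. length u = d}"

lemma homogeneous_invariant_in_span:
  assumes "p \<in> invariant_algebra n" "homogeneous d p"
  shows "p \<in> nc.span (orbit_sums_of_degree n d)"
proof -
  have "length u = d" if "NCMon u \<in> Poly_Mapping.keys p" for u
    using assms(2) that by (force simp: homogeneous_def)
  then show ?thesis
    by (subst invariant_eq_sum_of_orbit_sums[OF assms(1)], intro nc.span_sum nc.span_scale)
      (auto intro!: nc.span_base)
qed

lemma finite_orbit_minimal_of_length: "finite {u \<in> orbit_minimal_words n. length u = d}"
  by (rule finite_subset[OF _ finite_lists_length_eq[of "{1..n}" d]])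
    (auto simp: orbit_minimal_words_def)

lemma independent_orbit_sums:
  "inj_on (orbit_sum n) (orbit_minimal_words n)"
  "nc.independent (orbit_sum n ` orbit_minimal_words n)"
  using independent_of_has_min_word[of "\<lambda>u. u" "orbit_minimal_words n" "orbit_sum n"]
    has_min_word_orbit_sum by auto

lemma card_orbit_sums_of_degree:
  "card (orbit_sums_of_degree n d) = card {u \<in> orbit_minimal_words n. length u = d}"
proof (rule card_image)
  show "inj_on (orbit_sum n) {u \<in> orbit_minimal_words n. length u = d}"
    by (rule inj_on_subset[OF independent_orbit_sums(1)]) blast
qed

section \<open>Counting words by weight\<close>

definition words_of_weight :: "('a \<Rightarrow> nat) \<Rightarrow> 'a set \<Rightarrow> nat \<Rightarrow> 'a list set" where
  "words_of_weight wt B d = {W \<in> lists B. sum_list (map wt W) = d}"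

lemma finite_letters_of_weight:
  assumes "finite (words_of_weight wt B d)"
  shows "finite {b \<in> B. wt b = d}"
proof -
  have "finite ((\<lambda>b. [b]) ` {b \<in> B. wt b = d})"
    by (rule finite_subset[OF _ assms]) (auto simp: words_of_weight_def)
  then show ?thesis by (rule finite_imageD) (simp add: inj_on_def)
qed

lemma words_of_weight_0:
  assumes "\<forall>b\<in>B. wt b > 0"
  shows "words_of_weight wt B 0 = {[]}"
proof -
  have "W = []" if "W \<in> words_of_weight wt B 0" for W
    using that assms by (cases W) (fastforce simp: words_of_weight_def)+
  then show ?thesis by (auto simp: words_of_weight_def)
qed

text \<open>Split a nonempty word after its first letter, whose weight is \<open>k\<close>. Positivity of the weights
  bounds \<open>k\<close> below by 1, which makes this a recursion.\<close>

lemma card_words_of_weight: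
  assumes pos: "\<forall>b\<in>B. wt b > 0"
    and fin: "\<And>d. finite (words_of_weight wt B d)" and d: "d \<ge> 1"
  shows "card (words_of_weight wt B d) =
    (\<Sum>k=1..d. card {b \<in> B. wt b = k} * card (words_of_weight wt B (d - k)))"
proof -
  let ?X = "\<lambda>k. {b \<in> B. wt b = k} \<times> words_of_weight wt B (d - k)"
  let ?c = "\<lambda>(b, W). b # W"
  have "words_of_weight wt B d = (\<Union>k\<in>{1..d}. ?c ` ?X k)"
  proof (intro set_eqI iffI)
    fix V assume V: "V \<in> words_of_weight wt B d"
    then obtain b W where bW: "V = b # W" using d by (cases V) (auto simp: words_of_weight_def)
    have "wt b \<in> {1..d}" using V pos by (auto simp: words_of_weight_def bW)
    moreover have "V \<in> ?c ` ?X (wt b)" using V by (force simp: words_of_weight_def bW)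
    ultimately show "V \<in> (\<Union>k\<in>{1..d}. ?c ` ?X k)" by blast
  qed (auto simp: words_of_weight_def)
  also have "card \<dots> = (\<Sum>k=1..d. card (?c ` ?X k))"
    using fin finite_letters_of_weight[OF fin]
    by (intro card_UN_disjoint) auto
  also have "\<dots> = (\<Sum>k=1..d. card {b \<in> B. wt b = k} * card (words_of_weight wt B (d - k)))"
    by (intro sum.cong refl) (subst card_image, auto simp: inj_on_def card_cartesian_product)
  finally show ?thesis .
qed

text \<open>In the recursion for weight \<open>d\<close>, the letters of weight \<open>d\<close> occur only in the summand with an empty
  remaining word; all other terms are determined by letters of smaller weight. So the numbers of words
  determine the numbers of letters.\<close>

lemma card_letters_eq_of_card_words_eq:
  assumes posB: "\<forall>b\<in>B. wt b > 0" and posC: "\<forall>c\<in>C. wt' c > 0"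
    and finB: "\<And>d. finite (words_of_weight wt B d)"
    and finC: "\<And>d. finite (words_of_weight wt' C d)"
    and eq: "\<And>d. card (words_of_weight wt B d) = card (words_of_weight wt' C d)"
    and "d \<ge> 1"
  shows "card {b \<in> B. wt b = d} = card {c \<in> C. wt' c = d}"
  using \<open>d \<ge> 1\<close>
proof (induction d rule: less_induct)
  case (less d)
  have split: "{1..d} = insert d {1..<d}" using less.prems by auto
  have "card (words_of_weight wt B d) = card {b \<in> B. wt b = d} +
      (\<Sum>k=1..<d. card {b \<in> B. wt b = k} * card (words_of_weight wt B (d - k)))"
    unfolding card_words_of_weight[OF posB finB less.prems] split
    by (simp add: words_of_weight_0[OF posB])
  moreover have "card (words_of_weight wt' C d) = card {c \<in> C. wt' c = d} +
      (\<Sum>k=1..<d. card {c \<in> C. wt' c = k} * card (words_of_weight wt' C (d - k)))"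
    unfolding card_words_of_weight[OF posC finC less.prems] split
    by (simp add: words_of_weight_0[OF posC])
  moreover have "(\<Sum>k=1..<d. card {b \<in> B. wt b = k} * card (words_of_weight wt B (d - k)))
      = (\<Sum>k=1..<d. card {c \<in> C. wt' c = k} * card (words_of_weight wt' C (d - k)))"
    using less.IH eq by (intro sum.cong) auto
  ultimately show ?case using eq[of d] by simp
qed

section \<open>Prefix-closed submonoids of a free monoid are free\<close>

text \<open>For a prefix-closed monoid \<open>M\<close>, a factorization of \<open>u\<close> within \<open>M\<close> into two nonempty words exists as
  soon as some proper nonempty suffix lies in \<open>M\<close>.\<close>

definition indecomposables :: "'a list set \<Rightarrow> 'a list set" where
  "indecomposables M = {u \<in> M. u \<noteq> [] \<and> (\<forall>i. 0 < i \<and> i < length u \<longrightarrow> drop i u \<notin> M)}"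

lemma indecomposables_suffix_eq:
  assumes "p \<in> indecomposables M" "q \<in> indecomposables M" "u @ p = v @ q" "length p \<le> length q"
  shows "p = q"
proof (rule ccontr)
  assume "p \<noteq> q"
  obtain x where x: "q = x @ p" using assms(3,4) by (auto simp: append_eq_append_conv2)
  with \<open>p \<noteq> q\<close> have "0 < length x" "length x < length q" "drop (length x) q = p"
    using assms(1) by (auto simp: indecomposables_def)
  then show False using assms(1,2) by (force simp: indecomposables_def)
qed

text \<open>No indecomposable word is a proper suffix of another one, so the last factor of a concatenation can
  be recovered.\<close>

lemma inj_on_concat_indecomposables: "inj_on concat (lists (indecomposables M))"
proof (rule inj_onI)
  fix V W
  assume "V \<in> lists (indecomposables M)" "W \<in> lists (indecomposables M)" "concat V = concat W"
  then show "V = W"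
  proof (induction V arbitrary: W rule: rev_induct)
    case Nil
    then show ?case by (cases W) (auto simp: indecomposables_def)
  next
    case (snoc p V)
    have "W \<noteq> []" using snoc.prems by (auto simp: indecomposables_def)
    then obtain W' q where W: "W = W' @ [q]" by (metis append_butlast_last_id)
    have pq: "p \<in> indecomposables M" "q \<in> indecomposables M" "concat V @ p = concat W' @ q"
      using snoc.prems W by auto
    have "p = q"
      using indecomposables_suffix_eq[OF pq] indecomposables_suffix_eq[OF pq(2,1) pq(3)[symmetric]]
      by (metis nat_le_linear)
    moreover have "V = W'"
      using snoc.prems pq(3) \<open>p = q\<close> by (intro snoc.IH) (simp_all add: W)
    ultimately show ?case using W by simp
  qed
qed

text \<open>Cutting off the shortest nonempty suffix that lies in \<open>M\<close> leaves a prefix, which again lies in \<open>M\<close>.\<close>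

lemma bij_betw_concat_indecomposables:
  assumes nil: "[] \<in> M" and app: "\<And>u v. u \<in> M \<Longrightarrow> v \<in> M \<Longrightarrow> u @ v \<in> M"
    and prefix: "\<And>u v. u @ v \<in> M \<Longrightarrow> u \<in> M"
  shows "bij_betw concat (lists (indecomposables M)) M"
  unfolding bij_betw_def
proof (intro conjI inj_on_concat_indecomposables equalityI)
  show "concat ` lists (indecomposables M) \<subseteq> M"
  proof (intro image_subsetI)
    fix W assume "W \<in> lists (indecomposables M)"
    then show "concat W \<in> M"
      by (induction W) (auto simp: nil app indecomposables_def)
  qed
  show "M \<subseteq> concat ` lists (indecomposables M)"
  proof
    fix u assume "u \<in> M"
    then show "u \<in> concat ` lists (indecomposables M)"
    proof (induction u rule: length_induct)
      case (1 u)
      show ?case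
      proof (cases "u = []")
        case True
        then show ?thesis by (metis concat.simps(1) image_eqI lists.Nil)
      next
        case False
        let ?I = "{i. i < length u \<and> drop i u \<in> M}"
        have I: "finite ?I" "0 \<in> ?I" using 1(2) False by auto
        \<comment> \<open>the largest cutting position yields the shortest nonempty suffix in \<open>M\<close>\<close>
        define i where "i = Max ?I"
        have i: "i < length u" "drop i u \<in> M" using Max_in[OF I(1)] I(2) unfolding i_def by blast+
        have max: "j \<le> i" if "j < length u" "drop j u \<in> M" for j
          using Max_ge[OF I(1), of j] that by (simp add: i_def)
        have "drop i u \<in> indecomposables M"
          unfolding indecomposables_def
        proof (intro CollectI conjI allI impI)
          fix j assume j: "0 < j \<and> j < length (drop i u)"
          then have "j + i < length u" by (simp add: less_diff_conv)
          then show "drop j (drop i u) \<notin> M" using max[of "j + i"] j by (auto simp: add.commute)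
        next
          show "drop i u \<noteq> []" using i(1) by simp
        qed (rule i(2))
        moreover have "take i u \<in> concat ` lists (indecomposables M)"
        proof -
          have "take i u \<in> M" using 1(2) prefix[of "take i u" "drop i u"] by simp
          moreover have "length (take i u) < length u" using i(1) by simp
          ultimately show ?thesis using 1(1) by blast
        qed
        then obtain W where W: "W \<in> lists (indecomposables M)" "take i u = concat W" by blast
        ultimately have "W @ [drop i u] \<in> lists (indecomposables M)" by simp
        moreover have "u = concat (W @ [drop i u])"
          using append_take_drop_id[of i u] W(2) by simp
        ultimately show ?thesis by blast
      qed
    qed
  qed
qed

lemma bij_betw_concat_orbit_minimal:
  "bij_betw concat (lists (indecomposables (orbit_minimal_words n))) (orbit_minimal_words n)"
  by (intro bij_betw_concat_indecomposables Nil_orbit_minimal orbit_minimal_append)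
    (auto dest: orbit_minimal_prefix)

lemma bij_betw_concat_of_weight:
  "bij_betw concat (words_of_weight length (indecomposables (orbit_minimal_words n)) d)
    {u \<in> orbit_minimal_words n. length u = d}"
proof -
  let ?P = "indecomposables (orbit_minimal_words n)"
  have "concat ` words_of_weight length ?P d = {u \<in> concat ` lists ?P. length u = d}"
    unfolding words_of_weight_def by (auto simp: length_concat)
  then have "concat ` words_of_weight length ?P d = {u \<in> orbit_minimal_words n. length u = d}"
    using bij_betw_concat_orbit_minimal[of n] by (simp add: bij_betw_def)
  moreover have "inj_on concat (words_of_weight length ?P d)"
    by (rule inj_on_subset[OF inj_on_concat_indecomposables]) (auto simp: words_of_weight_def)
  ultimately show ?thesis by (simp add: bij_betw_def)
qed

section \<open>Free generators of the invariant algebra\<close>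

lemma orbit_sum_products:
  assumes "W \<in> lists (orbit_minimal_words n)"
  shows "has_min_word (concat W) (prod_list (map (orbit_sum n) W))"
    and "prod_list (map (orbit_sum n) W) \<in> invariant_algebra n"
proof -
  show "has_min_word (concat W) (prod_list (map (orbit_sum n) W))"
    using assms
    by (induction W) (simp_all add: has_min_word_one has_min_word_times has_min_word_orbit_sum)
  have "orbit_sum n u \<in> invariant_algebra n" if "u \<in> orbit_minimal_words n" for u
    using that orbit_sum_invariant unfolding orbit_minimal_words_def by blast
  with assms show "prod_list (map (orbit_sum n) W) \<in> invariant_algebra n"
    by (induction W) (simp_all add: one_in_invariant_algebra times_in_invariant_algebra)
qed

text \<open>The products of these orbit sums have pairwise different minimal words, by unique factorization of
  orbit-minimal words, and are therefore independent. In degree \<open>d\<close> there are as many of them as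
  orbit-minimal words of length \<open>d\<close>, which is the dimension of the space of invariants of degree \<open>d\<close>.
  So they form a basis.\<close>

lemma orbit_sums_freely_generate:
  "homogeneous_free_generating_set (invariant_algebra n)
    (orbit_sum n ` indecomposables (orbit_minimal_words n))"
proof -
  let ?M = "orbit_minimal_words n"
  let ?P = "indecomposables ?M"
  let ?f = "\<lambda>W. prod_list (map (orbit_sum n) W)"
  let ?X = "words_of_weight length ?P"
  have P: "?P \<subseteq> ?M" by (auto simp: indecomposables_def)
  then have lists: "W \<in> lists ?M" if "W \<in> lists ?P" for W using that by auto
  have indep: "inj_on ?f (lists ?P) \<and> nc.independent (?f ` lists ?P)"
    using orbit_sum_products(1) lists
    by (intro independent_of_has_min_word[OF inj_on_concat_indecomposables[of ?M]]) blast
  have prods: "prod_list ` lists (orbit_sum n ` ?P) = ?f ` lists ?P"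
    by (simp add: lists_image image_image)
  have inj: "inj_on prod_list (lists (orbit_sum n ` ?P))"
  proof (rule inj_onI)
    fix V W assume VW: "V \<in> lists (orbit_sum n ` ?P)" "W \<in> lists (orbit_sum n ` ?P)"
      "prod_list V = prod_list W"
    then obtain V' W' where *: "V = map (orbit_sum n) V'" "V' \<in> lists ?P"
      "W = map (orbit_sum n) W'" "W' \<in> lists ?P" by (auto simp: lists_image)
    then have "V' = W'" using VW(3) indep by (auto simp: inj_on_def)
    with * show "V = W" by simp
  qed
  have "nc.span (?f ` lists ?P) = invariant_algebra n"
  proof
    show "nc.span (?f ` lists ?P) \<subseteq> invariant_algebra n"
      using orbit_sum_products(2) lists
      by (intro nc.span_minimal subspace_invariant_algebra image_subsetI) blast
    have "orbit_sum n u \<in> nc.span (?f ` lists ?P)" if u: "u \<in> ?M" for u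
    proof -
      let ?d = "length u"
      let ?T = "orbit_sums_of_degree n ?d"
      have X: "?X ?d \<subseteq> lists ?P" by (auto simp: words_of_weight_def)
      have "?f ` ?X ?d \<subseteq> nc.span ?T"
      proof (intro image_subsetI homogeneous_invariant_in_span)
        fix W assume W: "W \<in> ?X ?d"
        then have "W \<in> lists ?M" using X lists by blast
        note prod = orbit_sum_products[OF this]
        show "?f W \<in> invariant_algebra n" by (rule prod)
        show "homogeneous ?d (?f W)"
          using prod(1) W by (simp add: has_min_word_def words_of_weight_def length_concat)
      qed
      moreover have "nc.independent (?f ` ?X ?d)"
        by (rule nc.independent_mono[OF conjunct2[OF indep] image_mono[OF X]])
      moreover have "card ?T = card (?f ` ?X ?d)"
      proof -
        have "card ?T = card {v \<in> ?M. length v = ?d}"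
          by (rule card_orbit_sums_of_degree)
        also have "\<dots> = card (?X ?d)"
          using bij_betw_same_card[OF bij_betw_concat_of_weight] by simp
        also have "\<dots> = card (?f ` ?X ?d)"
          using inj_on_subset[OF conjunct1[OF indep] X] by (rule card_image[symmetric])
        finally show ?thesis .
      qed
      moreover have "finite ?T" by (intro finite_imageI finite_orbit_minimal_of_length)
      ultimately have "nc.span ?T \<subseteq> nc.span (?f ` ?X ?d)"
        by (intro nc.span_subset_span_of_card_eq)
      moreover have "orbit_sum n u \<in> nc.span ?T" using u by (auto intro: nc.span_base)
      moreover have "nc.span (?f ` ?X ?d) \<subseteq> nc.span (?f ` lists ?P)"
        using X by (intro nc.span_mono) auto
      ultimately show ?thesis by blast
    qed
    then show "invariant_algebra n \<subseteq> nc.span (?f ` lists ?P)"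
      unfolding span_orbit_sums[symmetric] by (intro nc.span_minimal) auto
  qed
  then have "free_generating_set (invariant_algebra n) (orbit_sum n ` ?P)"
    unfolding free_generating_set_iff_basis prods using inj indep by simp
  moreover have "\<exists>d. homogeneous d b" if "b \<in> orbit_sum n ` ?P" for b
    using that P has_min_word_orbit_sum by (fastforce simp: has_min_word_def)
  ultimately show ?thesis by (simp add: homogeneous_free_generating_set_def)
qed

text \<open>The zero polynomial is homogeneous of every degree, so in general the degree is only a choice; for
  a free generator it is determined.\<close>

definition generator_degree :: "'a ncpoly \<Rightarrow> nat" where
  "generator_degree b = (SOME d. homogeneous d b)"

lemma homogeneous_unique:
  assumes "homogeneous d p" "homogeneous e p" "p \<noteq> 0"
  shows "d = e"
proof -
  obtain w where "word_coeff p w \<noteq> 0" using assms(3) ncpoly_eqI[of p 0] by auto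
  then show ?thesis using assms(1,2) by (metis homogeneous_iff)
qed

lemma homogeneous_0_eq_scalar:
  assumes "homogeneous 0 p"
  shows "p = scale_nc (word_coeff p []) 1"
proof (rule ncpoly_eqI)
  fix w
  show "word_coeff p w = word_coeff (scale_nc (word_coeff p []) 1) w"
    using assms
    by (cases w) (auto simp: word_coeff_scale homogeneous_iff lookup_one zero_ncmon_def)
qed

text \<open>The vector 0 does not occur in an independent set, and a generator of degree 0 would be a scalar
  multiple of the empty product.\<close>

lemma homogeneous_free_generators:
  assumes B: "homogeneous_free_generating_set A B" and b: "b \<in> B"
  shows "homogeneous d b \<longleftrightarrow> generator_degree b = d" and "generator_degree b > 0"
proof -
  have inj: "inj_on prod_list (lists B)" and indep: "nc.independent (prod_list ` lists B)"
    using B by (auto simp: homogeneous_free_generating_set_def free_generating_set_iff_basis)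
  have b_prod: "prod_list [b] \<in> prod_list ` lists B" using b by (intro imageI) simp
  have nz_prod: "0 \<notin> prod_list ` lists B"
    by (rule notI) (rule notE[OF indep], rule nc.dependent_zero)
  have nz: "b \<noteq> 0"
  proof
    assume "b = 0"
    then have "prod_list [b] = 0" by simp
    with b_prod have "0 \<in> prod_list ` lists B" by (simp only:)
    with nz_prod show False ..
  qed
  have "\<exists>d. homogeneous d b"
    using B b by (simp add: homogeneous_free_generating_set_def)
  then have hom: "homogeneous (generator_degree b) b"
    unfolding generator_degree_def by (rule someI_ex)
  show "homogeneous d b \<longleftrightarrow> generator_degree b = d"
    using hom homogeneous_unique[OF _ _ nz] by blast
  show "generator_degree b > 0"
  proof (rule ccontr)
    assume "\<not> generator_degree b > 0"
    then have scalar: "b = scale_nc (word_coeff b []) 1" using hom homogeneous_0_eq_scalar by simp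
    \<comment> \<open>\<open>b\<close> would then lie in the span of the empty product, which is another basis vector\<close>
    let ?S = "prod_list ` lists B - {prod_list [b]}"
    have "prod_list [] \<in> prod_list ` lists B" by (intro imageI) simp
    moreover have "prod_list [] \<noteq> prod_list [b]" using inj_onD[OF inj, of "[]" "[b]"] b by auto
    ultimately have "prod_list [] \<in> ?S" by blast
    then have "scale_nc (word_coeff b []) (prod_list []) \<in> nc.span ?S"
      by (intro nc.span_scale nc.span_base)
    then have "prod_list [b] \<in> nc.span ?S" using scalar by simp
    then have "nc.dependent (prod_list ` lists B)" unfolding nc.dependent_def using b_prod by (rule bexI)
    with indep show False ..
  qed
qed

lemma homogeneous_prod_list:
  assumes "\<And>b. b \<in> set W \<Longrightarrow> homogeneous (wt b) b"
  shows "homogeneous (sum_list (map wt W)) (prod_list W)"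
proof -
  have "homogeneous 0 (1 :: 'a ncpoly)" by (simp add: homogeneous_def zero_ncmon_def)
  with assms show ?thesis by (induction W) (simp_all add: homogeneous_times)
qed

text \<open>Both sides are the dimension of the space of invariants of degree \<open>d\<close>: on the left computed from
  the basis of products of generators, on the right from the basis of orbit sums.\<close>

lemma card_words_in_free_generators:
  assumes B: "homogeneous_free_generating_set (invariant_algebra n) B"
  shows "finite (words_of_weight generator_degree B d)"
    and "card (words_of_weight generator_degree B d) = card {u \<in> orbit_minimal_words n. length u = d}"
proof -
  let ?W = "words_of_weight generator_degree B d"
  let ?E = "prod_list ` ?W" and ?T = "orbit_sums_of_degree n d"
  have inj: "inj_on prod_list (lists B)" and indep: "nc.independent (prod_list ` lists B)"
    and span: "nc.span (prod_list ` lists B) = invariant_algebra n"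
    using B by (auto simp: homogeneous_free_generating_set_def free_generating_set_iff_basis)
  have W: "?W \<subseteq> lists B" by (auto simp: words_of_weight_def)
  have hom: "homogeneous (sum_list (map generator_degree V)) (prod_list V)" if "V \<in> lists B" for V
    using that homogeneous_free_generators(1)[OF B] by (intro homogeneous_prod_list) auto
  have finT: "finite ?T" by (intro finite_imageI finite_orbit_minimal_of_length)
  have indE: "nc.independent ?E" by (rule nc.independent_mono[OF indep image_mono[OF W]])
  have indT: "nc.independent ?T"
    by (rule nc.independent_mono[OF independent_orbit_sums(2)[of n] image_mono]) blast
  have ET: "?E \<subseteq> nc.span ?T"
  proof (intro image_subsetI homogeneous_invariant_in_span)
    fix V assume V: "V \<in> ?W"
    show "prod_list V \<in> invariant_algebra n"
      unfolding span[symmetric] using V W by (intro nc.span_base) blast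
    show "homogeneous d (prod_list V)" using hom[of V] V by (simp add: words_of_weight_def)
  qed
  have TE: "?T \<subseteq> nc.span ?E"
  proof
    fix p assume p: "p \<in> ?T"
    have p_hom: "homogeneous d p"
      using p has_min_word_orbit_sum by (auto simp: has_min_word_def)
    have "p \<in> nc.span (prod_list ` lists B)"
      unfolding span using p orbit_sum_invariant by (auto simp: orbit_minimal_words_def)
    then have "homogeneous_part d p \<in> nc.span {s \<in> prod_list ` lists B. homogeneous d s}"
      using hom by (intro homogeneous_part_mem_span) blast
    moreover have "{s \<in> prod_list ` lists B. homogeneous d s} \<subseteq> ?E"
    proof
      fix s assume s: "s \<in> {s \<in> prod_list ` lists B. homogeneous d s}"
      then obtain V where V: "V \<in> lists B" "s = prod_list V" by blast
      have "s \<noteq> 0"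
      proof
        assume "s = 0"
        moreover have "s \<in> prod_list ` lists B" using V by (simp only: imageI)
        ultimately have "0 \<in> prod_list ` lists B" by (simp only:)
        then show False by (rule notE[OF indep nc.dependent_zero])
      qed
      then have "sum_list (map generator_degree V) = d"
        using homogeneous_unique[OF hom[OF V(1)], of d] s V(2) by simp
      with V show "s \<in> ?E" by (auto simp: words_of_weight_def)
    qed
    ultimately have "homogeneous_part d p \<in> nc.span ?E" by (meson nc.span_mono subsetD)
    then show "p \<in> nc.span ?E" by (simp add: homogeneous_part_of_homogeneous[OF p_hom])
  qed
  have E: "finite ?E" "card ?E \<le> card ?T"
    using nc.independent_span_bound[OF finT indE ET] by auto
  have "card ?T \<le> card ?E" using nc.independent_span_bound[OF E(1) indT TE] by simp
  with E(2) have "card ?E = card ?T" by simp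
  moreover have injW: "inj_on prod_list ?W" using inj W by (rule inj_on_subset)
  moreover have "card ?T = card {u \<in> orbit_minimal_words n. length u = d}"
    by (rule card_orbit_sums_of_degree)
  ultimately show "card ?W = card {u \<in> orbit_minimal_words n. length u = d}"
    by (simp add: card_image)
  show "finite ?W" using E(1) injW by (rule finite_imageD)
qed

lemma card_free_generators_of_degree:
  assumes B: "homogeneous_free_generating_set (invariant_algebra n) B" and d: "d \<ge> 1"
  shows "finite {b \<in> B. homogeneous d b}"
    and "card {b \<in> B. homogeneous d b}
      = card {u \<in> indecomposables (orbit_minimal_words n). length u = d}"
proof -
  let ?P = "indecomposables (orbit_minimal_words n)"
  have deg: "{b \<in> B. homogeneous d b} = {b \<in> B. generator_degree b = d}"
    using homogeneous_free_generators(1)[OF B] by blast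
  note bij = bij_betw_concat_of_weight[of n]
  have finP: "finite (words_of_weight length ?P e)" for e
    using bij_betw_finite[OF bij] finite_orbit_minimal_of_length by blast
  have "card (words_of_weight generator_degree B e) = card (words_of_weight length ?P e)" for e
    using card_words_in_free_generators(2)[OF B] bij_betw_same_card[OF bij] by simp
  then show "card {b \<in> B. homogeneous d b} = card {u \<in> ?P. length u = d}"
    unfolding deg using homogeneous_free_generators(2)[OF B] card_words_in_free_generators(1)[OF B] finP d
    by (intro card_letters_eq_of_card_words_eq) (auto simp: indecomposables_def)
  show "finite {b \<in> B. homogeneous d b}"
    unfolding deg using card_words_in_free_generators(1)[OF B] by (rule finite_letters_of_weight)
qed

section \<open>Move-to-front and orbit-minimal words\<close>

\<comment> \<open>the lists \<open>[1..<Suc n]\<close> are compared as a whole and should not lose their last entry\<close>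
declare upt_Suc [simp del]

text \<open>Interpreting a word as a list of requests, \<open>foldr\<close> serves its last letter first and its first
  letter last, so the first letter of the word ends up in front.\<close>

definition move_to_front :: "'a \<Rightarrow> 'a list \<Rightarrow> 'a list" where
  "move_to_front x s = x # removeAll x s"

text \<open>The distinct letters in the order in which they first occur when the word is read from left to
  right: the most recently requested letter is the one in front.\<close>

abbreviation first_occurrences :: "'a list \<Rightarrow> 'a list" where
  "first_occurrences u \<equiv> foldr move_to_front u []"

text \<open>The requested letters come first, the others keep their relative order.\<close>

lemma foldr_move_to_front:
  "foldr move_to_front u s = first_occurrences u @ filter (\<lambda>x. x \<notin> set u) s"
  by (induction u) (auto simp: move_to_front_def removeAll_filter_not_eq intro!: filter_cong)

lemma set_first_occurrences: "set (first_occurrences u) = set u"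
  by (induction u) (auto simp: move_to_front_def)

lemma first_occurrences_snoc:
  "first_occurrences (u @ [y]) = first_occurrences u @ (if y \<in> set u then [] else [y])"
  using foldr_move_to_front[of u "[y]"] by (simp add: move_to_front_def)

lemma foldr_move_to_front_eq_self_iff:
  assumes "u \<in> lists {1..n}"
  shows "foldr move_to_front u [1..<Suc n] = [1..<Suc n] \<longleftrightarrow> (\<exists>k. first_occurrences u = [1..<Suc k])"
proof
  assume eq: "foldr move_to_front u [1..<Suc n] = [1..<Suc n]"
  let ?k = "length (first_occurrences u)"
  have app: "first_occurrences u @ filter (\<lambda>x. x \<notin> set u) [1..<Suc n] = [1..<Suc n]"
    using eq foldr_move_to_front[of u "[1..<Suc n]"] by simp
  have "?k \<le> n" using arg_cong[OF app, of length] by simp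
  have "first_occurrences u = take ?k [1..<Suc n]"
    using arg_cong[OF app, of "take ?k"] by simp
  also have "\<dots> = [1..<Suc ?k]" using \<open>?k \<le> n\<close> by (subst take_upt) auto
  finally show "\<exists>k. first_occurrences u = [1..<Suc k]" ..
next
  assume "\<exists>k. first_occurrences u = [1..<Suc k]"
  then obtain k where k: "first_occurrences u = [1..<Suc k]" ..
  have set_u: "set u = {1..<Suc k}" using set_first_occurrences[of u] k by simp
  have "k \<le> n" using assms set_u by (cases "k = 0") (auto simp: in_lists_conv_set)
  then have split: "[1..<Suc n] = [1..<Suc k] @ [Suc k..<Suc n]"
    using upt_add_eq_append[of 1 "Suc k" "n - k"] by simp
  have "filter (\<lambda>x. x \<notin> set u) [1..<Suc k] = []" unfolding set_u by (simp add: filter_empty_conv)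
  moreover have "filter (\<lambda>x. x \<notin> set u) [Suc k..<Suc n] = [Suc k..<Suc n]"
    unfolding set_u by (simp add: filter_id_conv)
  ultimately have "first_occurrences u @ filter (\<lambda>x. x \<notin> set u) [1..<Suc n] = [1..<Suc n]"
    unfolding split filter_append k by simp
  then show "foldr move_to_front u [1..<Suc n] = [1..<Suc n]"
    by (simp only: foldr_move_to_front[of u "[1..<Suc n]"])
qed

text \<open>If the letters of \<open>u\<close> are exactly \<open>1, \<dots>, k\<close> and a new letter \<open>y\<close> follows, then exchanging \<open>y\<close> with
  \<open>k + 1\<close> fixes \<open>u\<close>, so minimality forces \<open>y = k + 1\<close>. Conversely, a permutation that fixes \<open>u\<close> fixes
  \<open>1, \<dots>, k\<close> and cannot send \<open>k + 1\<close> to anything smaller.\<close>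

lemma orbit_minimal_iff_first_occurrences:
  assumes "u \<in> lists {1..n}"
  shows "u \<in> orbit_minimal_words n \<longleftrightarrow> (\<exists>k. first_occurrences u = [1..<Suc k])"
  using assms
proof (induction u rule: rev_induct)
  case Nil
  have "first_occurrences [] = [1..<Suc 0]" by simp
  then show ?case using Nil_orbit_minimal by blast
next
  case (snoc y u)
  have y: "y \<in> {1..n}" and u: "u \<in> lists {1..n}" using snoc.prems by auto
  have IH: "u \<in> orbit_minimal_words n \<longleftrightarrow> (\<exists>k. first_occurrences u = [1..<Suc k])"
    by (rule snoc.IH[OF u])
  show ?case
  proof
    assume min: "u @ [y] \<in> orbit_minimal_words n"
    then obtain k where k: "first_occurrences u = [1..<Suc k]" using IH orbit_minimal_prefix by blast
    have set_u: "set u = {1..<Suc k}" using set_first_occurrences[of u] k by simp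
    show "\<exists>k. first_occurrences (u @ [y]) = [1..<Suc k]"
    proof (cases "y \<in> set u")
      case True
      then show ?thesis unfolding first_occurrences_snoc using k by auto
    next
      case False
      then have "y \<ge> Suc k" using y set_u by auto
      have "y = Suc k"
      proof (rule ccontr)
        assume "y \<noteq> Suc k"
        let ?\<sigma> = "transpose y (Suc k)"
        have "?\<sigma> permutes {1..n}" using y \<open>y \<ge> Suc k\<close> by (intro permutes_swap_id) auto
        then have le: "u @ [y] \<le> map ?\<sigma> (u @ [y])" using min unfolding orbit_minimal_words_def by blast
        have "map ?\<sigma> u = u"
          using set_u \<open>y \<ge> Suc k\<close> by (intro map_idI) (auto simp: transpose_def)
        then have "u @ [y] \<le> u @ [Suc k]" using le by simp
        then show False using \<open>y \<ge> Suc k\<close> \<open>y \<noteq> Suc k\<close> by (simp add: append_le_append_iff)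
      qed
      then have "first_occurrences (u @ [y]) = [1..<Suc (Suc k)]"
        using k False \<open>y = Suc k\<close> unfolding first_occurrences_snoc by (simp add: upt_Suc_append)
      then show ?thesis ..
    qed
  next
    assume "\<exists>k. first_occurrences (u @ [y]) = [1..<Suc k]"
    then obtain k where k: "first_occurrences (u @ [y]) = [1..<Suc k]" ..
    have k': "first_occurrences u = [1..<Suc (length (first_occurrences u))]" (is "_ = [1..<Suc ?j]")
    proof -
      have "first_occurrences u = take ?j [1..<Suc k]"
        using arg_cong[OF k, of "take ?j"] unfolding first_occurrences_snoc by simp
      moreover have "?j \<le> k" using arg_cong[OF k, of length] unfolding first_occurrences_snoc by simp
      ultimately show ?thesis using take_upt[of 1 ?j "Suc k"] by simp
    qed
    then have u_min: "u \<in> orbit_minimal_words n" using IH by blast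
    have set_u: "set u = {1..<Suc ?j}" using set_first_occurrences[of u] k' by (metis set_upt)
    have "u @ [y] \<le> map \<sigma> (u @ [y])" if \<sigma>: "\<sigma> permutes {1..n}" for \<sigma>
    proof (cases "map \<sigma> u = u")
      case False
      then have "u < map \<sigma> u" using u_min \<sigma> by (force simp: orbit_minimal_words_def le_less)
      then show ?thesis by (simp add: append_le_append_iff)
    next
      case True
      then have fix_u: "\<sigma> x = x" if "x \<in> set u" for x using that by (metis map_eq_conv map_ident)
      have "y \<le> \<sigma> y"
      proof (cases "y \<in> set u")
        case True
        then show ?thesis using fix_u by simp
      next
        case False
        have app: "first_occurrences u @ [y] = [1..<Suc k]"
          using k False unfolding first_occurrences_snoc by simp
        have "?j + 1 = k" using arg_cong[OF app, of length] by simp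
        moreover have "y = k" using arg_cong[OF app, of last] \<open>?j + 1 = k\<close> by simp
        ultimately have "y = ?j + 1" by simp
        moreover have "\<sigma> y \<notin> set u" using fix_u False permutes_inj[OF \<sigma>] by (metis injD)
        moreover have "\<sigma> y \<ge> 1" using permutes_in_image[OF \<sigma>, of y] y by simp
        ultimately show ?thesis using set_u by auto
      qed
      then show ?thesis using True by (auto simp: append_le_append_iff)
    qed
    then show "u @ [y] \<in> orbit_minimal_words n"
      using snoc.prems by (simp add: orbit_minimal_words_def)
  qed
qed

corollary orbit_minimal_iff_move_to_front:
  assumes "u \<in> lists {1..n}"
  shows "u \<in> orbit_minimal_words n \<longleftrightarrow> foldr move_to_front u [1..<Suc n] = [1..<Suc n]"
  using foldr_move_to_front_eq_self_iff[OF assms] orbit_minimal_iff_first_occurrences[OF assms] by simp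

section \<open>Words in the Cayley graph\<close>

lemma cayley_cycle_values:
  assumes "k \<ge> 1"
  shows "cayley_cycle k 1 = k" and "map (cayley_cycle k) [2..<Suc k] = [1..<k]"
    and "i > k \<Longrightarrow> cayley_cycle k i = i"
proof -
  let ?cs = "1 # rev [2..<Suc k]"
  \<comment> \<open>a cycle maps its defining list to that list rotated by one place\<close>
  have "map (cayley_cycle k ^^ 1) ?cs = rotate 1 ?cs"
    unfolding cayley_cycle_def by (rule cyclic_rotation) auto
  also have "\<dots> = rev [1..<Suc k]"
    using assms upt_conv_Cons[of 1 "Suc k"] by (simp add: numeral_2_eq_2)
  also have "\<dots> = k # rev [1..<k]" using assms by (simp add: upt_Suc_append)
  finally have "cayley_cycle k 1 # rev (map (cayley_cycle k) [2..<Suc k]) = k # rev [1..<k]"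
    by (simp add: rev_map)
  then show "cayley_cycle k 1 = k" "map (cayley_cycle k) [2..<Suc k] = [1..<k]" by simp_all
  show "cayley_cycle k i = i" if "i > k"
    unfolding cayley_cycle_def using that assms by (intro id_outside_supp) auto
qed

text \<open>Write a permutation \<open>g\<close> as the list \<open>g 1, \<dots>, g n\<close>. Multiplying it on the right by \<open>cayley_cycle k\<close>
  moves the entry at position \<open>k\<close> to the front; this is the case of the identity.\<close>

lemma map_cayley_cycle:
  assumes "k \<in> {1..n}"
  shows "map (cayley_cycle k) [1..<Suc n] = move_to_front k [1..<Suc n]"
proof -
  have k: "k \<ge> 1" "k \<le> n" using assms by auto
  have split: "[a..<Suc n] = [a..<b] @ [b..<Suc n]" if "a \<le> b" "b \<le> Suc n" for a b
    using upt_add_eq_append[OF that(1), of "Suc n - b"] that by simp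
  have "map (cayley_cycle k) [Suc k..<Suc n] = [Suc k..<Suc n]"
    using cayley_cycle_values(3)[OF k(1)] by (intro map_idI) auto
  moreover have "[1..<Suc n] = 1 # [2..<Suc k] @ [Suc k..<Suc n]"
    using split[of 2 "Suc k"] upt_conv_Cons[of 1 "Suc n"] k by (simp add: numeral_2_eq_2)
  ultimately have "map (cayley_cycle k) [1..<Suc n] = k # [1..<k] @ [Suc k..<Suc n]"
    using cayley_cycle_values(1,2)[OF k(1)] by simp
  moreover have "[1..<Suc n] = [1..<k] @ k # [Suc k..<Suc n]"
    using split[of 1 k] upt_conv_Cons[of k "Suc n"] k by simp
  then have "removeAll k [1..<Suc n] = [1..<k] @ [Suc k..<Suc n]"
    by (simp add: removeAll_id)
  ultimately show ?thesis by (simp only: move_to_front_def)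
qed

lemma cayley_generators_eq:
  assumes "n \<ge> 1"
  shows "cayley_generators n = cayley_cycle ` {1..n}"
proof -
  have "cayley_cycle 1 = id" by (simp add: cayley_cycle_def)
  moreover have "{1..n} = insert 1 {2..n}" using assms by auto
  ultimately show ?thesis by (simp add: cayley_generators_def)
qed

lemma cayley_cycle_permutes:
  assumes "k \<in> {1..n}"
  shows "cayley_cycle k permutes {1..n}"
  unfolding cayley_cycle_def
  by (rule permutes_subset[OF cycle_permutes]) (use assms in auto)

lemma word_product_snoc: "word_product (ws @ [s]) = word_product ws \<circ> s"
proof -
  have "foldr (\<circ>) ws f = foldr (\<circ>) ws id \<circ> f" for f :: "'a \<Rightarrow> 'a"
    by (induction ws) (auto simp: comp_assoc)
  from this[of s] show ?thesis by (simp add: word_product_def)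
qed

lemma word_product_permutes:
  assumes "n \<ge> 1" "ws \<in> lists (cayley_generators n)"
  shows "word_product ws permutes {1..n}"
  using assms(2)
proof (induction ws rule: rev_induct)
  case Nil
  show ?case using permutes_id[of "{1..n}"] by (simp add: word_product_def id_def)
next
  case (snoc s ws)
  then obtain k where k: "k \<in> {1..n}" "s = cayley_cycle k"
    using cayley_generators_eq[OF assms(1)] by auto
  have "word_product ws permutes {1..n}" using snoc by simp
  with cayley_cycle_permutes[OF k(1)] show ?case
    unfolding word_product_snoc k(2) by (rule permutes_compose)
qed

text \<open>The entries that stand in front of the list after each step of the walk, latest step first. They
  encode the walk by the moved entries instead of by the positions from which they were moved. With
  this order, prefixes of the walk become suffixes of the encoding.\<close>

definition fronts :: "(nat \<Rightarrow> nat) list \<Rightarrow> nat list" where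
  "fronts ws = map (\<lambda>j. word_product (take j ws) 1) (rev [1..<Suc (length ws)])"

lemma length_fronts: "length (fronts ws) = length ws"
  by (simp add: fronts_def)

lemma fronts_Nil: "fronts [] = []"
  by (simp add: fronts_def)

lemma fronts_snoc: "fronts (ws @ [s]) = word_product ws (s 1) # fronts ws"
  by (auto simp: fronts_def word_product_snoc upt_Suc_append)

lemma drop_fronts_append: "drop (length vs) (fronts (ws @ vs)) = fronts ws"
proof (induction vs rule: rev_induct)
  case (snoc s vs)
  then show ?case using fronts_snoc[of "ws @ vs" s] by simp
qed simp

lemma fronts_take:
  assumes "j \<le> length ws"
  shows "fronts (take j ws) = drop (length ws - j) (fronts ws)"
  using drop_fronts_append[of "drop j ws" "take j ws"] by simp

lemma map_word_product:
  assumes "n \<ge> 1" "ws \<in> lists (cayley_generators n)"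
  shows "map (word_product ws) [1..<Suc n] = foldr move_to_front (fronts ws) [1..<Suc n]"
  using assms(2)
proof (induction ws rule: rev_induct)
  case Nil
  show ?case by (simp add: word_product_def fronts_Nil)
next
  case (snoc s ws)
  let ?g = "word_product ws"
  have ws: "ws \<in> lists (cayley_generators n)" using snoc.prems by simp
  obtain k where k: "k \<in> {1..n}" "s = cayley_cycle k"
    using snoc.prems cayley_generators_eq[OF assms(1)] by auto
  have inj: "inj ?g" using word_product_permutes[OF assms(1) ws] by (rule permutes_inj)
  have "map (word_product (ws @ [s])) [1..<Suc n] = map ?g (map s [1..<Suc n])"
    unfolding word_product_snoc by simp
  also have "\<dots> = map ?g (move_to_front k [1..<Suc n])"
    unfolding k(2) map_cayley_cycle[OF k(1)] ..
  also have "\<dots> = move_to_front (?g k) (map ?g [1..<Suc n])"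
    using inj by (simp add: move_to_front_def removeAll_filter_not_eq filter_map comp_def inj_eq)
  also have "?g k = ?g (s 1)" using cayley_cycle_values(1)[of k] k by simp
  also have "map ?g [1..<Suc n] = foldr move_to_front (fronts ws) [1..<Suc n]"
    by (rule snoc.IH[OF ws])
  finally show ?case by (simp only: fronts_snoc foldr.simps comp_def)
qed

lemma fronts_in_lists:
  assumes "n \<ge> 1" "ws \<in> lists (cayley_generators n)"
  shows "fronts ws \<in> lists {1..n}"
  using assms(2)
proof (induction ws rule: rev_induct)
  case Nil
  show ?case by (simp add: fronts_Nil)
next
  case (snoc s ws)
  have "word_product (ws @ [s]) permutes {1..n}"
    using word_product_permutes[OF assms(1) snoc.prems] .
  then have "word_product (ws @ [s]) 1 \<in> {1..n}"
    using assms(1) by (simp only: permutes_in_image) simp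
  then show ?case using snoc by (simp add: fronts_snoc word_product_snoc)
qed

text \<open>Given the current list, the position of an entry and the entry determine each other, so any sequence
  of entries is realized by exactly one walk.\<close>

lemma bij_betw_fronts:
  assumes n: "n \<ge> 1"
  shows "bij_betw fronts (lists (cayley_generators n)) (lists {1..n})"
  unfolding bij_betw_def
proof
  show "inj_on fronts (lists (cayley_generators n))"
  proof (rule inj_onI)
    fix ws vs
    assume "ws \<in> lists (cayley_generators n)" "vs \<in> lists (cayley_generators n)" "fronts ws = fronts vs"
    then show "ws = vs"
    proof (induction ws arbitrary: vs rule: rev_induct)
      case Nil
      then show ?case using length_fronts[of vs] by (simp add: fronts_Nil)
    next
      case (snoc s ws)
      have "vs \<noteq> []" using snoc.prems(3) by (auto simp: fronts_snoc fronts_Nil)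
      then obtain vs' t where vs: "vs = vs' @ [t]" by (metis append_butlast_last_id)
      have "fronts ws = fronts vs'" using snoc.prems(3) by (simp add: vs fronts_snoc)
      then have eq: "ws = vs'" using snoc.prems by (intro snoc.IH) (simp_all add: vs)
      have "word_product ws permutes {1..n}" using word_product_permutes[OF n] snoc.prems(1) by simp
      moreover have "word_product ws (s 1) = word_product ws (t 1)"
        using snoc.prems(3) by (simp add: vs fronts_snoc eq)
      ultimately have "s 1 = t 1" using permutes_inj inj_eq by metis
      moreover have "s \<in> cayley_cycle ` {1..n}" "t \<in> cayley_cycle ` {1..n}"
        using snoc.prems(1,2) cayley_generators_eq[OF n] by (simp_all add: vs)
      ultimately have "s = t" using cayley_cycle_values(1) by auto
      with eq vs show ?case by simp
    qed
  qed
  show "fronts ` lists (cayley_generators n) = lists {1..n}"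
  proof
    show "fronts ` lists (cayley_generators n) \<subseteq> lists {1..n}" using fronts_in_lists[OF n] by blast
    show "lists {1..n} \<subseteq> fronts ` lists (cayley_generators n)"
    proof
      fix u assume "u \<in> lists {1..n}"
      then show "u \<in> fronts ` lists (cayley_generators n)"
      proof (induction u)
        case Nil
        show ?case using fronts_Nil by (metis image_eqI lists.Nil)
      next
        case (Cons x u)
        then obtain ws where ws: "ws \<in> lists (cayley_generators n)" "u = fronts ws" by blast
        note g = word_product_permutes[OF n ws(1)]
        define k where "k = inv (word_product ws) x"
        have k: "k \<in> {1..n}" unfolding k_def using permutes_in_image[OF permutes_inv[OF g]] Cons by blast
        have "word_product ws k = x" unfolding k_def using permutes_inverses(1)[OF g] .
        then have "fronts (ws @ [cayley_cycle k]) = x # u"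
          using cayley_cycle_values(1)[of k] k ws(2) by (simp add: fronts_snoc)
        moreover have "ws @ [cayley_cycle k] \<in> lists (cayley_generators n)"
          using ws(1) k cayley_generators_eq[OF n] by simp
        ultimately show ?case by (metis image_eqI)
      qed
    qed
  qed
qed

text \<open>The walk ends at the identity if the list is back in increasing order. As the letters that were never
  moved stay in increasing order behind the others, this says that the moved letters, the most recently
  moved one first, are \<open>1, \<dots>, k\<close> in this order.\<close>

lemma reduces_to_id_iff:
  assumes "n \<ge> 1" "ws \<in> lists (cayley_generators n)"
  shows "reduces_to ws id \<longleftrightarrow> fronts ws \<in> orbit_minimal_words n"
proof -
  let ?g = "word_product ws"
  have g: "?g permutes {1..n}" by (rule word_product_permutes[OF assms])
  have "?g = id \<longleftrightarrow> (\<forall>x\<in>{1..n}. ?g x = x)"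
    using permutes_not_in[OF g] by (auto simp: fun_eq_iff)
  also have "\<dots> \<longleftrightarrow> map ?g [1..<Suc n] = [1..<Suc n]"
    using map_eq_conv[of ?g "[1..<Suc n]" "\<lambda>x. x"] by (simp add: atLeastLessThanSuc_atLeastAtMost)
  finally show ?thesis
    unfolding reduces_to_def map_word_product[OF assms]
    using orbit_minimal_iff_move_to_front[OF fronts_in_lists[OF assms]] by simp
qed

section \<open>Noncrossing words and indecomposable words\<close>

text \<open>A proper prefix of the walk that returns to the identity corresponds to a proper suffix of the encoding
  that is orbit-minimal, which is what indecomposability excludes.\<close>

lemma noncrossing_iff_indecomposable:
  assumes "n \<ge> 1" "d \<ge> 1" "ws \<in> lists (cayley_generators n)"
  shows "ws \<in> noncrossing_words n d \<longleftrightarrow>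
    fronts ws \<in> {u \<in> indecomposables (orbit_minimal_words n). length u = d}"
proof -
  let ?M = "orbit_minimal_words n"
  have red: "reduces_to (take j ws) id \<longleftrightarrow> drop (length ws - j) (fronts ws) \<in> ?M"
    if "j \<le> length ws" for j
  proof -
    have "take j ws \<in> lists (cayley_generators n)"
      using assms(3) by (auto simp: in_lists_conv_set dest: in_set_takeD)
    from reduces_to_id_iff[OF assms(1) this] show ?thesis using fronts_take[OF that] by simp
  qed
  have "crosses_identity ws \<longleftrightarrow> (\<exists>i. 0 < i \<and> i < length ws \<and> drop i (fronts ws) \<in> ?M)"
    unfolding crosses_identity_def
  proof
    assume "\<exists>j\<ge>1. j < length ws \<and> reduces_to (take j ws) id"
    then obtain j where "1 \<le> j" "j < length ws" "reduces_to (take j ws) id" by blast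
    then show "\<exists>i. 0 < i \<and> i < length ws \<and> drop i (fronts ws) \<in> ?M"
      using red[of j] by (intro exI[of _ "length ws - j"]) auto
  next
    assume "\<exists>i. 0 < i \<and> i < length ws \<and> drop i (fronts ws) \<in> ?M"
    then obtain i where "0 < i" "i < length ws" "drop i (fronts ws) \<in> ?M" by blast
    then show "\<exists>j\<ge>1. j < length ws \<and> reduces_to (take j ws) id"
      using red[of "length ws - i"] by (intro exI[of _ "length ws - i"]) auto
  qed
  moreover have "fronts ws \<noteq> []" if "length ws = d" using that assms(2) length_fronts[of ws] by auto
  ultimately show ?thesis
    using assms(3) reduces_to_id_iff[OF assms(1,3)]
    by (auto simp: noncrossing_words_def indecomposables_def length_fronts)
qed

lemma card_noncrossing_words:
  assumes "n \<ge> 1" "d \<ge> 1"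
  shows "card (noncrossing_words n d) = card {u \<in> indecomposables (orbit_minimal_words n). length u = d}"
proof (rule bij_betw_same_card)
  let ?C = "{u \<in> indecomposables (orbit_minimal_words n). length u = d}"
  have sub: "noncrossing_words n d \<subseteq> lists (cayley_generators n)"
    by (auto simp: noncrossing_words_def)
  have C: "?C \<subseteq> lists {1..n}" by (auto simp: indecomposables_def orbit_minimal_words_def)
  have "fronts ` noncrossing_words n d = ?C"
  proof
    show "fronts ` noncrossing_words n d \<subseteq> ?C"
      using noncrossing_iff_indecomposable[OF assms] sub by blast
    show "?C \<subseteq> fronts ` noncrossing_words n d"
    proof
      fix u assume u: "u \<in> ?C"
      then obtain ws where "ws \<in> lists (cayley_generators n)" "u = fronts ws"
        using C bij_betw_fronts[OF assms(1)] unfolding bij_betw_def by blast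
      then show "u \<in> fronts ` noncrossing_words n d"
        using u noncrossing_iff_indecomposable[OF assms, of ws] by blast
    qed
  qed
  moreover have "inj_on fronts (noncrossing_words n d)"
    using bij_betw_fronts[OF assms(1)] sub unfolding bij_betw_def by (blast intro: inj_on_subset)
  ultimately show "bij_betw fronts (noncrossing_words n d) ?C" by (simp add: bij_betw_def)
qed

theorem proposition4p20:
  fixes n :: nat
  assumes "n \<ge> 2"
  shows "(\<exists>B. homogeneous_free_generating_set (invariant_algebra n) B) \<and>
    (\<forall>B. homogeneous_free_generating_set (invariant_algebra n) B \<longrightarrow>
      (\<forall>d\<ge>1. finite {b \<in> B. homogeneous d b} \<and>
        card {b \<in> B. homogeneous d b} = card (noncrossing_words n d)))"
proof (intro conjI allI impI)
  show "\<exists>B. homogeneous_free_generating_set (invariant_algebra n) B"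
    using orbit_sums_freely_generate by blast
next
  fix B and d :: nat
  assume B: "homogeneous_free_generating_set (invariant_algebra n) B" and d: "d \<ge> 1"
  show "finite {b \<in> B. homogeneous d b}" by (rule card_free_generators_of_degree(1)[OF B d])
  show "card {b \<in> B. homogeneous d b} = card (noncrossing_words n d)"
    using card_free_generators_of_degree(2)[OF B d] card_noncrossing_words[of n d] assms d by simp
qed

end
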